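(* Let $M,N\ge 1$ be integers, let $\beta_{\mathrm d},\beta_{\mathrm{br}},\beta_{\mathrm{ru}},\bar\tau>0$, and let $\mathrm{SNR}$ be the optimal uplink SNR of the RIS-aided link defined in the context, with uncorrelated (independent) Rayleigh UE-BS and UE-RIS channels and a rank-1 LOS RIS-BS channel. Put $$F_{\mathrm u}=N(N-1)\frac{\pi}{4},\qquad B_{\mathrm u}=M^{3/2}+\frac{\sqrt M}{2},$$ $$C_{\mathrm{u1}}=\frac{N\sqrt\pi}{2}\left(\frac{\pi}{4}(N-1)(N-2)+3N-\frac32\right),$$ $$C_{\mathrm{u2}}=2N+\binom N2\left((N-2)(N-3)\frac{\pi^2}{8}+6+3\pi(N-1)\right).$$ Then $$\mathbb E\{\mathrm{SNR}\}=\left(\beta_{\mathrm d}M+\frac{\sqrt M N\pi}{2}\sqrt{\beta_{\mathrm d}\beta_{\mathrm{br}}\beta_{\mathrm{ru}}}+\beta_{\mathrm{br}}\beta_{\mathrm{ru}}M(N+F_{\mathrm u})\right)\bar\tau$$ and $$\begin{aligned}\mathrm{Var}\{\mathrm{SNR}\}=\Big(&\beta_{\mathrm d}^2M+\beta_{\mathrm d}^{3/2}\sqrt{\beta_{\mathrm{br}}\beta_{\mathrm{ru}}}\,N\pi\,(B_{\mathrm u}-M^{3/2})\\&+\beta_{\mathrm d}\beta_{\mathrm{br}}\beta_{\mathrm{ru}}M\Big(4(N+F_{\mathrm u})-\frac{N^2\pi^2}{4}\Big)\\&+M^{3/2}\sqrt{\beta_{\mathrm d}}\,(\beta_{\mathrm{br}}\beta_{\mathrm{ru}})^{3/2}\big(2\sqrt\pi\,C_{\mathrm{u1}}-N(N+F_{\mathrm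 u})\pi\big)\\&+(M\beta_{\mathrm{br}}\beta_{\mathrm{ru}})^2\big(C_{\mathrm{u2}}-(N+F_{\mathrm u})^2\big)\Big)\bar\tau^2.\end{aligned}$$
   Context: Channel model. $\mathbf u_{\mathrm d}\sim\mathcal{CN}(\mathbf 0,\mathbf I_M)$ and $\tilde{\mathbf h}_{\mathrm{ru}}\sim\mathcal{CN}(\mathbf 0,\mathbf I_N)$ are independent standard circularly symmetric complex Gaussian vectors (independent entries, each with second absolute moment 1). The UE-BS channel is $\mathbf h_{\mathrm d}=\sqrt{\beta_{\mathrm d}}\,\mathbf u_{\mathrm d}$; the UE-RIS channel is $\mathbf h_{\mathrm{ru}}=\sqrt{\beta_{\mathrm{ru}}}\,\tilde{\mathbf h}_{\mathrm{ru}}$. The RIS-BS channel is $\mathbf H_{\mathrm{br}}=\sqrt{\beta_{\mathrm{br}}}\,\mathbf a_{\mathrm b}\mathbf a_{\mathrm r}^H$, where the steering vectors $\mathbf a_{\mathrm b}\in\mathbb C^M$, $\mathbf a_{\mathrm r}\in\mathbb C^N$ are deterministic with all entries of modulus 1 (so $\lVert\mathbf a_{\mathrm b}\rVert_2=\sqrt M$). Optimal SNR. The global uplink channel is $\mathbf h=\mathbf h_{\mathrm d}+\mathbf H_{\mathrm{br}}\boldsymbol\Phi\mathbf h_{\mathrm{ru}}$ with the SNR-maximising RIS phase matrix $$\boldsymbol\Phi=\psi\,\mathrm{diag}\{e^{j\angle\mathbf a_{\mathrm r}}\}\,\mathrm{diag}\{e^{-j\angle\mathbf h_{\mathrm{ru}}}\},\qquad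 \psi=\frac{\mathbf a_{\mathrm b}^H\mathbf h_{\mathrm d}}{|\mathbf a_{\mathrm b}^H\mathbf h_{\mathrm d}|},$$ where angles and exponentials of vectors are taken entrywise. Hence $\mathbf h=\mathbf h_{\mathrm d}+\alpha\,\mathbf a_{\mathrm b}$ with $\alpha=\sqrt{\beta_{\mathrm{br}}\beta_{\mathrm{ru}}}\,\psi\,Y$ and $Y=\sum_{n=1}^N|\tilde h_{\mathrm{ru},n}|$, and the optimal uplink SNR is $$\mathrm{SNR}=\mathbf h^H\mathbf h\,\bar\tau=(\mathbf h_{\mathrm d}^H+\alpha^*\mathbf a_{\mathrm b}^H)(\mathbf h_{\mathrm d}+\alpha\,\mathbf a_{\mathrm b})\,\bar\tau.$$ *)

theory Defs
  imports "HOL-Probability.Probability"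
begin

definition std_complex_gaussian :: "'w measure \<Rightarrow> ('w \<Rightarrow> complex) \<Rightarrow> bool" where
  "std_complex_gaussian P X \<longleftrightarrow>
     prob_space.indep_var P borel (\<lambda>\<omega>. Re (X \<omega>)) borel (\<lambda>\<omega>. Im (X \<omega>)) \<and>
     distributed P lborel (\<lambda>\<omega>. Re (X \<omega>)) (normal_density 0 (sqrt (1 / 2))) \<and>
     distributed P lborel (\<lambda>\<omega>. Im (X \<omega>)) (normal_density 0 (sqrt (1 / 2)))"

definition std_complex_gaussian_vec :: "'w measure \<Rightarrow> ('w \<Rightarrow> complex ^ 'k) \<Rightarrow> bool" where
  "std_complex_gaussian_vec P X \<longleftrightarrow>
     prob_space.indep_vars P (\<lambda>_. borel) (\<lambda>i \<omega>. X \<omega> $ i) UNIV \<and>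
     (\<forall>i. std_complex_gaussian P (\<lambda>\<omega>. X \<omega> $ i))"

text \<open>The library's \<open>indep_var\<close> forces both variables to have the same value type, which
  excludes a pair of vectors of different dimensions.\<close>

definition indep_rv ::
  "'w measure \<Rightarrow> ('w \<Rightarrow> 'a::topological_space) \<Rightarrow> ('w \<Rightarrow> 'b::topological_space) \<Rightarrow> bool" where
  "indep_rv P X Y \<longleftrightarrow>
     X \<in> borel_measurable P \<and> Y \<in> borel_measurable P \<and>
     prob_space.indep_set P {X -` A \<inter> space P | A. A \<in> sets borel}
                            {Y -` B \<inter> space P | B. B \<in> sets borel}"

text \<open>The product \<open>x\<^sup>H y\<close>; the library's \<open>\<bullet>\<close> on complex vectors is only its real part.\<close>

definition herm :: "complex ^ 'k \<Rightarrow> complex ^ 'k \<Rightarrow> complex" where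
  "herm x y = (\<Sum>i\<in>UNIV. cnj (x $ i) * y $ i)"

definition outer_herm :: "complex ^ 'm \<Rightarrow> complex ^ 'n \<Rightarrow> complex ^ 'n ^ 'm" where
  "outer_herm x y = (\<chi> i j. x $ i * cnj (y $ j))"

definition diag_mat :: "complex ^ 'n \<Rightarrow> complex ^ 'n ^ 'n" where
  "diag_mat v = (\<chi> i j. if i = j then v $ i else 0)"

definition bs_phase :: "complex ^ 'm \<Rightarrow> complex ^ 'm \<Rightarrow> complex" where
  "bs_phase ab hdir = herm ab hdir / of_real (cmod (herm ab hdir))"

definition ris_phase_matrix ::
  "complex ^ 'm \<Rightarrow> complex ^ 'n \<Rightarrow> complex ^ 'm \<Rightarrow> complex ^ 'n \<Rightarrow> complex ^ 'n ^ 'n" where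
  "ris_phase_matrix ab ar hdir hru =
     mat (bs_phase ab hdir) ** diag_mat (\<chi> n. exp (\<i> * of_real (Arg (ar $ n))))
       ** diag_mat (\<chi> n. exp (- \<i> * of_real (Arg (hru $ n))))"

definition ris_bs_channel ::
  "real \<Rightarrow> complex ^ 'm \<Rightarrow> complex ^ 'n \<Rightarrow> complex ^ 'n ^ 'm" where
  "ris_bs_channel \<beta>br ab ar = sqrt \<beta>br *\<^sub>R outer_herm ab ar"

definition global_channel ::
  "real \<Rightarrow> real \<Rightarrow> real \<Rightarrow> complex ^ 'm \<Rightarrow> complex ^ 'n
    \<Rightarrow> complex ^ 'm \<Rightarrow> complex ^ 'n \<Rightarrow> complex ^ 'm" where
  "global_channel \<beta>d \<beta>br \<beta>ru ab ar ud htru =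
     (let hdir = sqrt \<beta>d *\<^sub>R ud;
          hru = sqrt \<beta>ru *\<^sub>R htru
      in hdir + (ris_bs_channel \<beta>br ab ar ** ris_phase_matrix ab ar hdir hru) *v hru)"

text \<open>The real part only changes the type: \<open>h\<^sup>H h\<close> is real by \<open>herm_self\<close> below.\<close>

definition optimal_snr ::
  "real \<Rightarrow> real \<Rightarrow> real \<Rightarrow> real \<Rightarrow> complex ^ 'm \<Rightarrow> complex ^ 'n
    \<Rightarrow> complex ^ 'm \<Rightarrow> complex ^ 'n \<Rightarrow> real" where
  "optimal_snr \<beta>d \<beta>br \<beta>ru \<tau> ab ar ud htru =
     (let h = global_channel \<beta>d \<beta>br \<beta>ru ab ar ud htru in Re (herm h h) * \<tau>)"

definition F_u :: "nat \<Rightarrow> real" where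
  "F_u N = real N * (real N - 1) * (pi / 4)"

definition B_u :: "nat \<Rightarrow> real" where
  "B_u M = real M powr (3 / 2) + sqrt (real M) / 2"

definition C_u1 :: "nat \<Rightarrow> real" where
  "C_u1 N = real N * sqrt pi / 2 *
     (pi / 4 * (real N - 1) * (real N - 2) + 3 * real N - 3 / 2)"

definition C_u2 :: "nat \<Rightarrow> real" where
  "C_u2 N = 2 * real N + real (N choose 2) *
     ((real N - 2) * (real N - 3) * (pi\<^sup>2 / 8) + 6 + 3 * pi * (real N - 1))"

lemma herm_self: "herm h h = of_real ((norm h)\<^sup>2)"
proof -
  have "cnj (h $ i) * h $ i = of_real ((norm (h $ i))\<^sup>2)" for i
    by (metis complex_norm_square mult.commute)
  then show ?thesis
    by (simp add: herm_def norm_vec_def L2_set_def sum_nonneg)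
qed

lemma diag_mat_mult_vec: "diag_mat v *v x = (\<chi> i. v $ i * x $ i)"
proof -
  have "(if i = j then v $ i else 0) * x $ j = (if i = j then v $ j * x $ j else 0)" for i j
    by simp
  then show ?thesis
    by (simp add: diag_mat_def matrix_vector_mult_def vec_eq_iff)
qed

lemma mat_mult_vec: "mat c *v x = (\<chi> i. c * x $ i)" for x :: "complex ^ 'n"
proof -
  have "(mat c :: complex ^ 'n ^ 'n) = diag_mat (\<chi> i. c)"
    by (simp add: mat_def diag_mat_def vec_eq_iff)
  then show ?thesis
    by (simp add: diag_mat_mult_vec)
qed

lemma global_channel_eq:
  assumes ar: "\<And>n. cmod (ar $ n) = 1" and "\<beta>ru \<ge> 0"
  shows "global_channel \<beta>d \<beta>br \<beta>ru ab ar ud htru =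
     sqrt \<beta>d *\<^sub>R ud +
     (of_real (sqrt (\<beta>br * \<beta>ru)) * bs_phase ab (sqrt \<beta>d *\<^sub>R ud)
        * of_real (\<Sum>n\<in>UNIV. cmod (htru $ n))) *s ab"
proof -
  define h where "h = sqrt \<beta>ru *\<^sub>R htru"
  define p where "p = bs_phase ab (sqrt \<beta>d *\<^sub>R ud)"
  have arg: "exp (- \<i> * of_real (Arg z)) * z = of_real (cmod z)" for z
  proof -
    have "z = of_real (cmod z) * exp (\<i> * of_real (Arg z))"
      using rcis_cmod_Arg[of z] by (simp add: rcis_def cis_conv_exp)
    then have "exp (- \<i> * of_real (Arg z)) * z
        = of_real (cmod z) * (exp (- \<i> * of_real (Arg z)) * exp (\<i> * of_real (Arg z)))"
      by (metis mult.left_commute)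
    also have "\<dots> = of_real (cmod z)"
      by (simp flip: exp_add)
    finally show ?thesis .
  qed
  have "cnj (ar $ n) * exp (\<i> * of_real (Arg (ar $ n))) = 1" for n
  proof -
    have "exp (\<i> * of_real (Arg (ar $ n))) = ar $ n"
      using rcis_cmod_Arg[of "ar $ n"] ar[of n] by (simp add: rcis_def cis_conv_exp)
    then show ?thesis
      using ar[of n] by (metis complex_norm_square mult.commute of_real_1 one_power2)
  qed
  then have entry: "cnj (ar $ n) * (p * (exp (\<i> * of_real (Arg (ar $ n))) *
      (exp (- \<i> * of_real (Arg (h $ n))) * h $ n))) = p * of_real (cmod (h $ n))" for n
    by (metis arg mult.assoc mult.commute mult_1)
  have "(ris_bs_channel \<beta>br ab ar ** ris_phase_matrix ab ar (sqrt \<beta>d *\<^sub>R ud) h) *v h =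
      ris_bs_channel \<beta>br ab ar *v
        (\<chi> n. p * (exp (\<i> * of_real (Arg (ar $ n))) * (exp (- \<i> * of_real (Arg (h $ n))) * h $ n)))"
    by (simp add: ris_phase_matrix_def p_def diag_mat_mult_vec mat_mult_vec
        flip: matrix_vector_mul_assoc)
  also have "\<dots> = (\<chi> i. of_real (sqrt \<beta>br) * ab $ i *
      (\<Sum>n\<in>UNIV. cnj (ar $ n) * (p * (exp (\<i> * of_real (Arg (ar $ n))) *
      (exp (- \<i> * of_real (Arg (h $ n))) * h $ n)))))"
    unfolding matrix_vector_mult_def ris_bs_channel_def outer_herm_def vec_eq_iff
    by (simp add: sum_distrib_left mult.assoc scaleR_conv_of_real[where 'a = complex])
  also have "\<dots> = (of_real (sqrt (\<beta>br * \<beta>ru)) * p *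
      of_real (\<Sum>n\<in>UNIV. cmod (htru $ n))) *s ab"
    unfolding entry using \<open>\<beta>ru \<ge> 0\<close>
    by (simp add: h_def vec_eq_iff real_sqrt_mult mult.assoc mult.commute mult.left_commute
        flip: sum_distrib_left)
  finally show ?thesis
    by (simp add: global_channel_def Let_def h_def p_def)
qed

end

theory Submission
  imports Defs
begin

text \<open>Off the null set where \<open>herm ab ud = 0\<close>, the SNR divided by \<open>\<tau>\<close> equals
  \<open>\<beta>d S + 2 sqrt (\<beta>d \<beta>br \<beta>ru) X Y + \<beta>br \<beta>ru M Y\<^sup>2\<close>, where \<open>S = \<bar>ud\<bar>\<^sup>2\<close> and \<open>X = \<bar>herm ab ud\<bar>\<close> are
  independent of \<open>Y\<close>, a sum of independent Rayleigh variables. The moments of \<open>X\<close> are obtained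
  without rotating Gaussian vectors: \<open>2 \<bar>z\<bar>\<close> is the integral of \<open>\<bar>Re (cis t * z)\<bar>\<close> over \<open>0 \<le> t \<le> pi\<close>,
  and each real part of a linear combination of complex Gaussians is a real Gaussian, so
  \<open>E \<bar>\<Sum>j. c j * u j\<bar> = sqrt pi / 2 * \<bar>c\<bar>\<close> for all coefficients \<open>c\<close>. The weight
  \<open>exp (- h * \<bar>u i\<bar>\<^sup>2)\<close> only rescales \<open>u i\<close>, so differentiating this formula at \<open>h = 0\<close> yields the mixed
  moments \<open>E (\<bar>u i\<bar>\<^sup>2 X)\<close>, hence \<open>E (S X)\<close>, and also the third Rayleigh moment.\<close>

section \<open>Linear combinations of complex Gaussians\<close>

text \<open>\<open>Re (cis t * z)\<close> equals \<open>cmod z * cos (t + Arg z)\<close>, and the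
  absolute value of a cosine has integral 2 over every interval of length \<open>pi\<close>. A
  modulus thus becomes an average of real projections; with nonnegative integrals the order of
  integration can later be exchanged without prior integrability.\<close>

lemma nn_integral_abs_Re_cis:
  "(\<integral>\<^sup>+t. ennreal \<bar>Re (cis t * z)\<bar> * indicator {0..pi} t \<partial>lborel) = ennreal (2 * cmod z)"
proof -
  \<comment> \<open>For \<open>Re z \<ge> 0\<close> the angle \<open>p = - Arg z\<close> lies
    between \<open>- pi / 2\<close> and \<open>pi / 2\<close>, so on \<open>{0..pi}\<close> the
    factor \<open>cos (t - p)\<close> is nonnegative up to \<open>p + pi / 2\<close> and nonpositive
    from there on.\<close>
  have *: "(\<integral>\<^sup>+t. ennreal \<bar>Re (cis t * z)\<bar> * indicator {0..pi} t \<partial>lborel) = ennreal (2 * cmod z)"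
    if "Re z \<ge> 0" for z
  proof -
    define r p where "r = cmod z" and "p = - Arg z"
    have z: "z = of_real r * cis (- p)"
      using rcis_cmod_Arg[of z] by (simp add: rcis_def r_def p_def)
    have p: "\<bar>p\<bar> \<le> pi / 2" using that Arg_Re_nonneg[of z] by (simp add: p_def)
    have re: "Re (cis t * z) = r * cos (t - p)" for t
      by (simp add: z cos_diff sin_diff algebra_simps)
    have r: "r \<ge> 0" by (simp add: r_def)
    have pos: "cos (t - p) \<ge> 0" if "t \<in> {0..p + pi / 2}" for t
      using that p by (intro cos_ge_zero) auto
    have neg: "cos (t - p) \<le> 0" if "t \<in> {p + pi / 2..pi}" for t
    proof -
      have "cos (t - p - pi) \<ge> 0"
        using that p by (intro cos_ge_zero) auto
      then show ?thesis by (simp add: cos_diff)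
    qed
    have "(\<integral>\<^sup>+t. ennreal \<bar>Re (cis t * z)\<bar> * indicator {0..pi} t \<partial>lborel)
      = (\<integral>\<^sup>+t. ennreal (r * cos (t - p)) * indicator {0..p + pi / 2} t
          + ennreal (- r * cos (t - p)) * indicator {p + pi / 2..pi} t \<partial>lborel)"
    \<comment> \<open>The two closed pieces share the point \<open>p + pi / 2\<close>, which is
      discarded as a null set.\<close>
    proof (rule nn_integral_cong_AE, use AE_lborel_singleton[of "p + pi / 2"] in eventually_elim)
      case (elim t)
      then show ?case
        using p r pos[of t] neg[of t] unfolding re abs_mult
        by (auto split: split_indicator)
    qed
    also have "\<dots> = (\<integral>\<^sup>+t. ennreal (r * cos (t - p)) * indicator {0..p + pi / 2} t \<partial>lborel)
        + (\<integral>\<^sup>+t. ennreal (- r * cos (t - p)) * indicator {p + pi / 2..pi} t \<partial>lborel)"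
      by (rule nn_integral_add) auto
    also have "(\<integral>\<^sup>+t. ennreal (r * cos (t - p)) * indicator {0..p + pi / 2} t \<partial>lborel)
        = ennreal (r * sin (p + pi / 2 - p) - r * sin (0 - p))"
      using p r pos by (intro nn_integral_FTC_Icc) (auto intro!: derivative_eq_intros)
    also have "(\<integral>\<^sup>+t. ennreal (- r * cos (t - p)) * indicator {p + pi / 2..pi} t \<partial>lborel)
        = ennreal (- r * sin (pi - p) - - r * sin (p + pi / 2 - p))"
      using p r neg by (intro nn_integral_FTC_Icc)
        (auto intro!: derivative_eq_intros simp: mult_nonneg_nonpos)
    also have "ennreal (r * sin (p + pi / 2 - p) - r * sin (0 - p))
        + ennreal (- r * sin (pi - p) - - r * sin (p + pi / 2 - p)) = ennreal (2 * cmod z)"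
    proof -
      have "0 \<le> r * (1 + sin p)" "0 \<le> r * (1 - sin p)"
        using r sin_ge_minus_one[of p] sin_le_one[of p] by (intro mult_nonneg_nonneg; linarith)+
      then show ?thesis
        by (simp add: algebra_simps flip: ennreal_plus r_def)
    qed
    finally show ?thesis .
  qed
  \<comment> \<open>Replacing \<open>z\<close> by \<open>- z\<close> changes neither side, so the
    other half plane reduces to the case above.\<close>
  show ?thesis
  proof (cases "Re z \<ge> 0")
    case False
    then show ?thesis using *[of "- z"] by (simp add: abs_minus_commute)
  qed (rule *)
qed

text \<open>\<open>Re (c * X)\<close> is \<open>Re c * Re X - Im c * Im X\<close>, a combination of
  independent centred normals whose variances add up to \<open>(cmod c)\<^sup>2 / 2\<close>.\<close>

lemma (in prob_space) normal_Re_mult_std_complex_gaussian: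
  assumes X: "std_complex_gaussian M X" and "c \<noteq> 0"
  shows "distributed M lborel (\<lambda>\<omega>. Re (c * X \<omega>)) (normal_density 0 (cmod c * sqrt (1 / 2)))"
proof -
  have ind: "indep_var borel (\<lambda>\<omega>. Re (X \<omega>)) borel (\<lambda>\<omega>. Im (X \<omega>))"
    and re: "distributed M lborel (\<lambda>\<omega>. Re (X \<omega>)) (normal_density 0 (sqrt (1 / 2)))"
    and im: "distributed M lborel (\<lambda>\<omega>. Im (X \<omega>)) (normal_density 0 (sqrt (1 / 2)))"
    using X by (auto simp: std_complex_gaussian_def)
  have re': "distributed M lborel (\<lambda>\<omega>. a * Re (X \<omega>)) (normal_density 0 (\<bar>a\<bar> * sqrt (1 / 2)))"
    and im': "distributed M lborel (\<lambda>\<omega>. a * Im (X \<omega>)) (normal_density 0 (\<bar>a\<bar> * sqrt (1 / 2)))"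
    if "a \<noteq> 0" for a
    using normal_density_affine[OF re, of a 0] normal_density_affine[OF im, of a 0] that by auto
  \<comment> \<open>A summand with coefficient 0 is constant and has no normal density, so
    additivity of independent normals applies only when both parts of \<open>c\<close> are
    nonzero.\<close>
  consider "Re c = 0" "Im c \<noteq> 0" | "Im c = 0" "Re c \<noteq> 0" | "Re c \<noteq> 0" "Im c \<noteq> 0"
    using \<open>c \<noteq> 0\<close> by (auto simp: complex_eq_iff)
  then show ?thesis
  proof cases
    case 3
    have "indep_var borel ((\<lambda>x. Re c * x) \<circ> (\<lambda>\<omega>. Re (X \<omega>))) borel ((\<lambda>x. - Im c * x) \<circ> (\<lambda>\<omega>. Im (X \<omega>)))"
      by (rule indep_var_compose[OF ind]) auto
    then have "indep_var borel (\<lambda>\<omega>. Re c * Re (X \<omega>)) borel (\<lambda>\<omega>. - Im c * Im (X \<omega>))"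
      by (simp add: comp_def)
    from add_indep_normal[OF this _ _ re' im'] 3
    have "distributed M lborel (\<lambda>\<omega>. Re c * Re (X \<omega>) + - Im c * Im (X \<omega>))
        (normal_density 0 (sqrt ((\<bar>Re c\<bar> * sqrt (1 / 2))\<^sup>2 + (\<bar>- Im c\<bar> * sqrt (1 / 2))\<^sup>2)))"
      by (simp del: real_sqrt_divide)
    moreover have "sqrt ((\<bar>Re c\<bar> * sqrt (1 / 2))\<^sup>2 + (\<bar>- Im c\<bar> * sqrt (1 / 2))\<^sup>2) = cmod c * sqrt (1 / 2)"
      unfolding cmod_def real_sqrt_mult[symmetric]
      by (simp add: power_mult_distrib power_divide field_simps)
    ultimately show ?thesis by simp
  qed (use re'[of "Re c"] im'[of "- Im c"] in \<open>auto simp: cmod_def\<close>)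
qed

lemma (in prob_space) normal_Re_sum_std_complex_gaussian:
  assumes "finite I" "I \<noteq> {}" "indep_vars (\<lambda>_. borel) X I"
    and "\<And>i. i \<in> I \<Longrightarrow> std_complex_gaussian M (X i)" "\<And>i. i \<in> I \<Longrightarrow> c i \<noteq> 0"
  shows "distributed M lborel (\<lambda>\<omega>. Re (\<Sum>i\<in>I. c i * X i \<omega>))
      (normal_density 0 (sqrt ((\<Sum>i\<in>I. (cmod (c i))\<^sup>2) / 2)))"
proof -
  have "distributed M lborel (\<lambda>\<omega>. \<Sum>i\<in>I. Re (c i * X i \<omega>))
      (normal_density (\<Sum>i\<in>I. 0) (sqrt (\<Sum>i\<in>I. (cmod (c i) * sqrt (1 / 2))\<^sup>2)))"
  proof (rule sum_indep_normal)
    show "indep_vars (\<lambda>i. borel) (\<lambda>i \<omega>. Re (c i * X i \<omega>)) I"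
      by (rule indep_vars_compose2[OF assms(3), where Y = "\<lambda>i x. Re (c i * x)"]) simp
  qed (use assms normal_Re_mult_std_complex_gaussian in auto)
  also have "(\<Sum>i\<in>I. (cmod (c i) * sqrt (1 / 2))\<^sup>2) = (\<Sum>i\<in>I. (cmod (c i))\<^sup>2) / 2"
    by (simp add: power_mult_distrib power_divide sum_divide_distrib)
  finally show ?thesis by simp
qed

lemma (in prob_space) nn_integral_abs_normal:
  assumes "distributed M lborel X (normal_density 0 \<sigma>)" "\<sigma> > 0"
  shows "(\<integral>\<^sup>+\<omega>. ennreal \<bar>X \<omega>\<bar> \<partial>M) = ennreal (\<sigma> * sqrt (2 / pi))"
proof -
  have "(\<integral>\<^sup>+\<omega>. ennreal \<bar>X \<omega>\<bar> \<partial>M) = (\<integral>\<^sup>+x. ennreal (normal_density 0 \<sigma> x) * ennreal \<bar>x\<bar> \<partial>lborel)"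
    by (subst distributed_nn_integral[OF assms(1)]) auto
  also have "\<dots> = (\<integral>\<^sup>+x. ennreal (normal_density 0 \<sigma> x * \<bar>x\<bar>) \<partial>lborel)"
    by (simp add: ennreal_mult' normal_density_nonneg)
  also have "\<dots> = ennreal (\<sigma> * sqrt (2 / pi))"
    using normal_moment_abs_odd[OF assms(2), of 0 0]
    by (intro nn_integral_eq_integral[THEN trans])
      (auto simp: has_bochner_integral_iff normal_density_nonneg)
  finally show ?thesis .
qed

text \<open>Rotating all coefficients by \<open>cis t\<close> preserves their moduli, so every
  projection of the sum has the same real normal law, whatever \<open>t\<close> is. Averaging the
  projections over \<open>{0..pi}\<close> and exchanging integrals gives twice the expected
  modulus.\<close>

lemma (in prob_space) nn_integral_cmod_sum_std_complex_gaussian: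
  assumes "finite I" "I \<noteq> {}" "indep_vars (\<lambda>_. borel) X I"
    and X: "\<And>i. i \<in> I \<Longrightarrow> std_complex_gaussian M (X i)" and c: "\<And>i. i \<in> I \<Longrightarrow> c i \<noteq> 0"
  shows "(\<integral>\<^sup>+\<omega>. ennreal (cmod (\<Sum>i\<in>I. c i * X i \<omega>)) \<partial>M)
    = ennreal (sqrt pi / 2 * sqrt (\<Sum>i\<in>I. (cmod (c i))\<^sup>2))"
proof -
  let ?Z = "\<lambda>\<omega>. \<Sum>i\<in>I. c i * X i \<omega>"
  define Q where "Q = (\<Sum>i\<in>I. (cmod (c i))\<^sup>2)"
  have "Q > 0"
    using assms unfolding Q_def by (intro sum_pos) auto
  have [measurable]: "X i \<in> borel_measurable M" if "i \<in> I" for i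
    using assms(3) that by (auto simp: indep_vars_def)
  have [measurable]: "?Z \<in> borel_measurable M"
    by measurable
  have "cis \<in> borel_measurable borel"
    by (intro borel_measurable_continuous_onI continuous_on_cis continuous_intros)
  note [measurable] = this
  \<comment> \<open>The standard deviation is \<open>sqrt (Q / 2)\<close>, and
    \<open>sqrt (Q / 2) * sqrt (2 / pi)\<close> is \<open>sqrt (Q / pi)\<close>.\<close>
  have proj: "(\<integral>\<^sup>+\<omega>. ennreal \<bar>Re (cis t * ?Z \<omega>)\<bar> \<partial>M) = ennreal (sqrt (Q / pi))" for t
  proof -
    have "distributed M lborel (\<lambda>\<omega>. Re (\<Sum>i\<in>I. cis t * c i * X i \<omega>))
        (normal_density 0 (sqrt ((\<Sum>i\<in>I. (cmod (cis t * c i))\<^sup>2) / 2)))"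
      using assms by (intro normal_Re_sum_std_complex_gaussian) auto
    then have "distributed M lborel (\<lambda>\<omega>. Re (cis t * ?Z \<omega>)) (normal_density 0 (sqrt (Q / 2)))"
      by (simp add: Q_def norm_mult sum_distrib_left mult.assoc)
    from nn_integral_abs_normal[OF this] \<open>Q > 0\<close> show ?thesis
      by (simp flip: real_sqrt_mult)
  qed
  have "(\<integral>\<^sup>+\<omega>. ennreal (2 * cmod (?Z \<omega>)) \<partial>M)
      = (\<integral>\<^sup>+\<omega>. \<integral>\<^sup>+t. ennreal \<bar>Re (cis t * ?Z \<omega>)\<bar> * indicator {0..pi} t \<partial>lborel \<partial>M)"
    by (simp only: nn_integral_abs_Re_cis)
  also have "\<dots> = (\<integral>\<^sup>+t. \<integral>\<^sup>+\<omega>. ennreal \<bar>Re (cis t * ?Z \<omega>)\<bar> * indicator {0..pi} t \<partial>M \<partial>lborel)"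
  proof -
    interpret pair_sigma_finite M lborel ..
    show ?thesis by (intro Fubini'[symmetric]) measurable
  qed
  also have "\<dots> = (\<integral>\<^sup>+t. ennreal (sqrt (Q / pi)) * indicator {0..pi} t \<partial>lborel)"
    by (intro nn_integral_cong, subst nn_integral_multc) (measurable, simp only: proj)
  also have "\<dots> = ennreal (sqrt (Q / pi)) * ennreal pi"
    by (subst nn_integral_cmult_indicator) auto
  also have "\<dots> = ennreal (sqrt (Q / pi) * pi)"
    using \<open>Q > 0\<close> by (simp add: ennreal_mult')
  finally have eq: "(\<integral>\<^sup>+\<omega>. ennreal (2 * cmod (?Z \<omega>)) \<partial>M) = ennreal (sqrt (Q / pi) * pi)" .
  have "(\<integral>\<^sup>+\<omega>. ennreal (cmod (?Z \<omega>)) \<partial>M) = (\<integral>\<^sup>+\<omega>. ennreal (1 / 2) * ennreal (2 * cmod (?Z \<omega>)) \<partial>M)"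
    by (intro nn_integral_cong, subst ennreal_mult'[symmetric]) auto
  also have "\<dots> = ennreal (1 / 2) * ennreal (sqrt (Q / pi) * pi)"
    by (subst nn_integral_cmult) (auto simp: eq)
  also have "\<dots> = ennreal (1 / 2 * (sqrt (Q / pi) * pi))"
    by (subst ennreal_mult') auto
  also have "sqrt (Q / pi) * pi = sqrt pi * sqrt Q"
    unfolding real_sqrt_divide
    by (metis mult.commute pi_ge_zero real_div_sqrt times_divide_eq_left times_divide_eq_right)
  finally show ?thesis by (simp add: Q_def mult.commute)
qed

section \<open>Gaussian reweighting\<close>

text \<open>The joint law of independent variables is the product of the marginal laws, so Tonelli
  applies; each marginal integral is then pulled back to the sample space, with its own sample
  point.\<close>

lemma (in prob_space) nn_integral_indep_var:
  assumes "indep_var S X T Y" and F: "F \<in> borel_measurable (S \<Otimes>\<^sub>M T)"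
  shows "(\<integral>\<^sup>+\<omega>. F (X \<omega>, Y \<omega>) \<partial>M) = (\<integral>\<^sup>+\<omega>. \<integral>\<^sup>+\<omega>'. F (X \<omega>, Y \<omega>') \<partial>M \<partial>M)"
proof -
  have [measurable]: "X \<in> measurable M S" "Y \<in> measurable M T"
    and eq: "distr M S X \<Otimes>\<^sub>M distr M T Y = distr M (S \<Otimes>\<^sub>M T) (\<lambda>x. (X x, Y x))"
    using assms(1) by (auto simp: indep_var_distribution_eq)
  note [measurable] = F
  interpret Y: prob_space "distr M T Y"
    by (rule prob_space_distr) simp
  have "(\<integral>\<^sup>+\<omega>. F (X \<omega>, Y \<omega>) \<partial>M) = (\<integral>\<^sup>+z. F z \<partial>distr M (S \<Otimes>\<^sub>M T) (\<lambda>x. (X x, Y x)))"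
    by (subst nn_integral_distr) auto
  also have "\<dots> = (\<integral>\<^sup>+x. \<integral>\<^sup>+y. F (x, y) \<partial>distr M T Y \<partial>distr M S X)"
    unfolding eq[symmetric] by (subst Y.nn_integral_fst[symmetric]) auto
  also have "\<dots> = (\<integral>\<^sup>+x. \<integral>\<^sup>+\<omega>'. F (x, Y \<omega>') \<partial>M \<partial>distr M S X)"
    by (intro nn_integral_cong, subst nn_integral_distr) auto
  also have "\<dots> = (\<integral>\<^sup>+\<omega>. \<integral>\<^sup>+\<omega>'. F (X \<omega>, Y \<omega>') \<partial>M \<partial>M)"
    by (subst nn_integral_distr) auto
  finally show ?thesis .
qed

text \<open>The hypotheses on \<open>X\<close> and \<open>Y\<close> say that a weight acts on each
  law as a scalar factor combined with a change of variable. Independence makes the two actions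
  apply coordinatewise, even when \<open>F\<close> is not a product.\<close>

lemma (in prob_space) nn_integral_indep_var_reweight:
  assumes ind: "indep_var S X T Y" and F[measurable]: "F \<in> borel_measurable (S \<Otimes>\<^sub>M T)"
    and [measurable]: "v \<in> borel_measurable S" "w \<in> borel_measurable T"
      "\<phi> \<in> measurable S S" "\<psi> \<in> measurable T T"
    and X: "\<And>f. f \<in> borel_measurable S \<Longrightarrow>
      (\<integral>\<^sup>+\<omega>. v (X \<omega>) * f (X \<omega>) \<partial>M) = a * (\<integral>\<^sup>+\<omega>. f (\<phi> (X \<omega>)) \<partial>M)"
    and Y: "\<And>f. f \<in> borel_measurable T \<Longrightarrow>
      (\<integral>\<^sup>+\<omega>. w (Y \<omega>) * f (Y \<omega>) \<partial>M) = b * (\<integral>\<^sup>+\<omega>. f (\<psi> (Y \<omega>)) \<partial>M)"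
  shows "(\<integral>\<^sup>+\<omega>. v (X \<omega>) * w (Y \<omega>) * F (X \<omega>, Y \<omega>) \<partial>M)
    = a * b * (\<integral>\<^sup>+\<omega>. F (\<phi> (X \<omega>), \<psi> (Y \<omega>)) \<partial>M)"
proof -
  have [measurable]: "X \<in> measurable M S" "Y \<in> measurable M T"
    using ind by (auto simp: indep_var_distribution_eq)
  have "(\<integral>\<^sup>+\<omega>. v (X \<omega>) * w (Y \<omega>) * F (X \<omega>, Y \<omega>) \<partial>M)
      = (\<integral>\<^sup>+\<omega>. \<integral>\<^sup>+\<omega>'. v (X \<omega>) * w (Y \<omega>') * F (X \<omega>, Y \<omega>') \<partial>M \<partial>M)"
    using nn_integral_indep_var[OF ind, of "\<lambda>(x, y). v x * w y * F (x, y)"] by simp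
  also have "\<dots> = (\<integral>\<^sup>+\<omega>. v (X \<omega>) * (b * \<integral>\<^sup>+\<omega>'. F (X \<omega>, \<psi> (Y \<omega>')) \<partial>M) \<partial>M)"
  \<comment> \<open>With the first coordinate frozen, \<open>v (X \<omega>)\<close> is a constant
    and the rule for \<open>Y\<close> applies to the section of \<open>F\<close>.\<close>
  proof (intro nn_integral_cong)
    fix \<omega> assume [simp, measurable]: "\<omega> \<in> space M"
    have [measurable]: "X \<omega> \<in> space S"
      by (auto intro: measurable_space)
    show "(\<integral>\<^sup>+\<omega>'. v (X \<omega>) * w (Y \<omega>') * F (X \<omega>, Y \<omega>') \<partial>M)
        = v (X \<omega>) * (b * \<integral>\<^sup>+\<omega>'. F (X \<omega>, \<psi> (Y \<omega>')) \<partial>M)"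
      by (subst Y[symmetric]) (auto simp: nn_integral_cmult[symmetric] mult.assoc)
  qed
  also have "\<dots> = a * (\<integral>\<^sup>+\<omega>. b * \<integral>\<^sup>+\<omega>'. F (\<phi> (X \<omega>), \<psi> (Y \<omega>')) \<partial>M \<partial>M)"
    by (rule X) measurable
  also have "\<dots> = a * b * (\<integral>\<^sup>+\<omega>. \<integral>\<^sup>+\<omega>'. F (\<phi> (X \<omega>), \<psi> (Y \<omega>')) \<partial>M \<partial>M)"
    by (subst nn_integral_cmult) (auto simp: mult.assoc)
  also have "(\<integral>\<^sup>+\<omega>. \<integral>\<^sup>+\<omega>'. F (\<phi> (X \<omega>), \<psi> (Y \<omega>')) \<partial>M \<partial>M) = (\<integral>\<^sup>+\<omega>. F (\<phi> (X \<omega>), \<psi> (Y \<omega>)) \<partial>M)"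
    using nn_integral_indep_var[OF ind, of "\<lambda>(x, y). F (\<phi> x, \<psi> y)"] by simp
  finally show ?thesis .
qed

text \<open>The factor \<open>exp (- h * x\<^sup>2)\<close> raises the inverse variance from
  \<open>1 / \<sigma>\<^sup>2\<close> to \<open>s\<^sup>2 / \<sigma>\<^sup>2\<close>. Up to the
  normalising factor \<open>1 / s\<close>, the weighted density is therefore that of
  \<open>X / s\<close>.\<close>

lemma (in prob_space) normal_gaussian_reweight:
  fixes f :: "real \<Rightarrow> ennreal"
  assumes X: "distributed M lborel X (normal_density 0 \<sigma>)" and "\<sigma> > 0" "h \<ge> 0"
    and f[measurable]: "f \<in> borel_measurable borel"
  defines "s \<equiv> sqrt (1 + 2 * h * \<sigma>\<^sup>2)"
  shows "(\<integral>\<^sup>+\<omega>. ennreal (exp (- h * (X \<omega>)\<^sup>2)) * f (X \<omega>) \<partial>M)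
    = ennreal (1 / s) * (\<integral>\<^sup>+\<omega>. f (X \<omega> / s) \<partial>M)"
proof -
  have s: "s > 0" and s2: "s\<^sup>2 = 1 + 2 * h * \<sigma>\<^sup>2"
    using \<open>h \<ge> 0\<close> by (auto simp: s_def add_pos_nonneg)
  have Xs: "distributed M lborel (\<lambda>\<omega>. X \<omega> / s) (normal_density 0 (\<sigma> / s))"
    using normal_density_affine[OF X \<open>\<sigma> > 0\<close>, of "1 / s" 0] s by (simp add: field_simps)
  have dens: "normal_density 0 \<sigma> x * exp (- h * x\<^sup>2) = 1 / s * normal_density 0 (\<sigma> / s) x" for x
  proof -
    have "exp (- (x\<^sup>2 / (2 * \<sigma>\<^sup>2))) * exp (- h * x\<^sup>2) = exp (- (x\<^sup>2 / (2 * (\<sigma> / s)\<^sup>2)))"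
      using \<open>\<sigma> > 0\<close> s unfolding exp_add[symmetric]
      by (simp add: power_divide s2 field_simps)
    then show ?thesis
      using \<open>\<sigma> > 0\<close> s
      by (simp add: normal_density_def real_sqrt_divide power_divide real_sqrt_mult field_simps)
  qed
  have "(\<integral>\<^sup>+\<omega>. ennreal (exp (- h * (X \<omega>)\<^sup>2)) * f (X \<omega>) \<partial>M)
      = (\<integral>\<^sup>+x. ennreal (normal_density 0 \<sigma> x) * (ennreal (exp (- h * x\<^sup>2)) * f x) \<partial>lborel)"
    by (subst distributed_nn_integral[OF X]) auto
  also have "\<dots> = (\<integral>\<^sup>+x. ennreal (1 / s) * (ennreal (normal_density 0 (\<sigma> / s) x) * f x) \<partial>lborel)"
    by (intro nn_integral_cong)
      (metis (no_types) dens ennreal_mult' mult.assoc normal_density_nonneg exp_ge_zero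
          less_imp_le s zero_le_divide_1_iff)
  also have "\<dots> = ennreal (1 / s) * (\<integral>\<^sup>+\<omega>. f (X \<omega> / s) \<partial>M)"
    by (subst nn_integral_cmult) (auto simp: distributed_nn_integral[OF Xs])
  finally show ?thesis .
qed

text \<open>The weight splits into one factor for each of the independent real and imaginary parts.
  Both have variance 1/2, so each is rescaled by \<open>sqrt (1 + h)\<close> and the two normalising
  factors multiply to \<open>1 / (1 + h)\<close>.\<close>

lemma (in prob_space) std_complex_gaussian_reweight:
  fixes f :: "complex \<Rightarrow> ennreal"
  assumes X: "std_complex_gaussian M X" and "h \<ge> 0"
    and f[measurable]: "f \<in> borel_measurable borel"
  shows "(\<integral>\<^sup>+\<omega>. ennreal (exp (- h * (cmod (X \<omega>))\<^sup>2)) * f (X \<omega>) \<partial>M)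
    = ennreal (1 / (1 + h)) * (\<integral>\<^sup>+\<omega>. f (X \<omega> / of_real (sqrt (1 + h))) \<partial>M)"
proof -
  let ?s = "sqrt (1 + h)"
  define G where "G = (\<lambda>p :: real \<times> real. f (Complex (fst p) (snd p)))"
  have [measurable]: "(\<lambda>p. Complex (fst p) (snd p)) \<in> borel_measurable (borel \<Otimes>\<^sub>M borel)"
    unfolding borel_prod
    by (intro borel_measurable_continuous_onI) (auto simp: Complex_eq intro!: continuous_intros)
  have [measurable]: "G \<in> borel_measurable (borel \<Otimes>\<^sub>M borel)"
    unfolding G_def by measurable
  have ind: "indep_var borel (\<lambda>\<omega>. Re (X \<omega>)) borel (\<lambda>\<omega>. Im (X \<omega>))"
    and re: "distributed M lborel (\<lambda>\<omega>. Re (X \<omega>)) (normal_density 0 (sqrt (1 / 2)))"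
    and im: "distributed M lborel (\<lambda>\<omega>. Im (X \<omega>)) (normal_density 0 (sqrt (1 / 2)))"
    using X by (auto simp: std_complex_gaussian_def)
  have "(\<integral>\<^sup>+\<omega>. ennreal (exp (- h * (cmod (X \<omega>))\<^sup>2)) * f (X \<omega>) \<partial>M)
     = (\<integral>\<^sup>+\<omega>. ennreal (exp (- h * (Re (X \<omega>))\<^sup>2)) * ennreal (exp (- h * (Im (X \<omega>))\<^sup>2))
          * G (Re (X \<omega>), Im (X \<omega>)) \<partial>M)"
    by (intro nn_integral_cong)
      (simp add: G_def cmod_power2 distrib_left flip: ennreal_mult exp_add)
  also have "\<dots> = ennreal (1 / ?s) * ennreal (1 / ?s) *
      (\<integral>\<^sup>+\<omega>. G (Re (X \<omega>) / ?s, Im (X \<omega>) / ?s) \<partial>M)"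
    using normal_gaussian_reweight[OF re _ \<open>h \<ge> 0\<close>] normal_gaussian_reweight[OF im _ \<open>h \<ge> 0\<close>]
    by (intro nn_integral_indep_var_reweight[OF ind, where v = "\<lambda>x. ennreal (exp (- h * x\<^sup>2))"
          and w = "\<lambda>x. ennreal (exp (- h * x\<^sup>2))"]) auto
  also have "ennreal (1 / ?s) * ennreal (1 / ?s) = ennreal (1 / (1 + h))"
    using \<open>h \<ge> 0\<close> by (simp flip: ennreal_mult)
  also have "(\<lambda>\<omega>. G (Re (X \<omega>) / ?s, Im (X \<omega>) / ?s)) = (\<lambda>\<omega>. f (X \<omega> / of_real ?s))"
    by (auto simp: G_def complex_eq_iff Re_divide_of_real Im_divide_of_real intro!: arg_cong[of _ _ f])
  finally show ?thesis .
qed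

text \<open>The weight acts on \<open>X i\<close> alone, which is independent of the remaining sum.
  Rescaling \<open>X i\<close> amounts to dividing the coefficient \<open>c i\<close> by
  \<open>sqrt (1 + h)\<close>, and the first moment formula holds for the new coefficients as
  well.\<close>

lemma (in prob_space) nn_integral_exp_cmod_sum_std_complex_gaussian:
  assumes I: "finite I" "i \<in> I" and ind: "indep_vars (\<lambda>_. borel) X I"
    and X: "\<And>i. i \<in> I \<Longrightarrow> std_complex_gaussian M (X i)" and c: "\<And>i. i \<in> I \<Longrightarrow> c i \<noteq> 0"
    and "h \<ge> 0"
  shows "(\<integral>\<^sup>+\<omega>. ennreal (exp (- h * (cmod (X i \<omega>))\<^sup>2) * cmod (\<Sum>j\<in>I. c j * X j \<omega>)) \<partial>M)
    = ennreal (1 / (1 + h) * (sqrt pi / 2 *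
        sqrt ((\<Sum>j\<in>I - {i}. (cmod (c j))\<^sup>2) + (cmod (c i))\<^sup>2 / (1 + h))))"
proof -
  define s where "s = sqrt (1 + h)"
  have s: "s > 0" "s\<^sup>2 = 1 + h" using \<open>h \<ge> 0\<close> by (auto simp: s_def)
  define G where "G = (\<lambda>\<omega>. \<Sum>j\<in>I - {i}. c j * X j \<omega>)"
  have "indep_var borel ((\<lambda>f. f i) \<circ> (\<lambda>\<omega>. restrict (\<lambda>j. X j \<omega>) {i}))
      borel ((\<lambda>f. \<Sum>j\<in>I - {i}. c j * f j) \<circ> (\<lambda>\<omega>. restrict (\<lambda>j. X j \<omega>) (I - {i})))"
    using I by (intro indep_var_compose[OF indep_var_restrict[OF ind]]) auto
  also have "(\<lambda>f. f i) \<circ> (\<lambda>\<omega>. restrict (\<lambda>j. X j \<omega>) {i}) = X i"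
    by auto
  also have "(\<lambda>f. \<Sum>j\<in>I - {i}. c j * f j) \<circ> (\<lambda>\<omega>. restrict (\<lambda>j. X j \<omega>) (I - {i})) = G"
    by (auto simp: G_def intro!: sum.cong)
  finally have XG: "indep_var borel (X i) borel G" .
  \<comment> \<open>The coefficient \<open>d\<close> at \<open>i\<close> is left free to cover both
    the original value \<open>c i\<close> and the rescaled one.\<close>
  have split: "(\<Sum>j\<in>I. (c(i := d)) j * X j \<omega>) = d * X i \<omega> + G \<omega>" for d \<omega>
    using I by (simp add: sum.remove[of I i] G_def)
  have "(\<integral>\<^sup>+\<omega>. ennreal (exp (- h * (cmod (X i \<omega>))\<^sup>2) * cmod (\<Sum>j\<in>I. c j * X j \<omega>)) \<partial>M)
    = (\<integral>\<^sup>+\<omega>. ennreal (exp (- h * (cmod (X i \<omega>))\<^sup>2)) * 1 *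
        (\<lambda>(x, y). ennreal (cmod (c i * x + y))) (X i \<omega>, G \<omega>) \<partial>M)"
    using split[of "c i"] by (simp add: ennreal_mult')
  also have "\<dots> = ennreal (1 / (1 + h)) * 1 *
      (\<integral>\<^sup>+\<omega>. (\<lambda>(x, y). ennreal (cmod (c i * x + y))) (X i \<omega> / of_real s, G \<omega>) \<partial>M)"
    unfolding s_def
    by (intro nn_integral_indep_var_reweight[OF XG, where w = "\<lambda>_. 1" and \<psi> = "\<lambda>y. y"]
        std_complex_gaussian_reweight X I \<open>h \<ge> 0\<close>) auto
  also have "\<dots> = ennreal (1 / (1 + h)) *
      (\<integral>\<^sup>+\<omega>. ennreal (cmod (\<Sum>j\<in>I. (c(i := c i / of_real s)) j * X j \<omega>)) \<partial>M)"
    by (subst split) simp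
  also have "(\<integral>\<^sup>+\<omega>. ennreal (cmod (\<Sum>j\<in>I. (c(i := c i / of_real s)) j * X j \<omega>)) \<partial>M)
    = ennreal (sqrt pi / 2 * sqrt (\<Sum>j\<in>I. (cmod ((c(i := c i / of_real s)) j))\<^sup>2))"
    using I s by (intro nn_integral_cmod_sum_std_complex_gaussian ind) (auto simp: X c)
  also have "(\<Sum>j\<in>I. (cmod ((c(i := c i / of_real s)) j))\<^sup>2)
    = (\<Sum>j\<in>I - {i}. (cmod (c j))\<^sup>2) + (cmod (c i))\<^sup>2 / (1 + h)"
    using I s by (simp add: sum.remove[of I i] norm_divide power_divide)
  finally show ?thesis
    using \<open>h \<ge> 0\<close> by (simp only: ennreal_mult' zero_le_divide_1_iff)
qed

section \<open>Even moments of a single Gaussian\<close>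

lemma (in prob_space) normal_moment_even_expectation:
  assumes X: "distributed M lborel X (normal_density 0 \<sigma>)" and "\<sigma> > 0"
  shows "integrable M (\<lambda>\<omega>. X \<omega> ^ (2 * k))"
    and "expectation (\<lambda>\<omega>. X \<omega> ^ (2 * k)) = fact (2 * k) / ((2 / \<sigma>\<^sup>2) ^ k * fact k)"
  using normal_moment_even[OF \<open>\<sigma> > 0\<close>, of 0 k]
    distributed_integral[OF X, of "\<lambda>x. x ^ (2 * k)"]
    distributed_integrable[OF X, of "\<lambda>x. x ^ (2 * k)"]
  by (auto simp: has_bochner_integral_iff)

lemma (in prob_space) std_complex_gaussian_cmod_power4:
  assumes X: "std_complex_gaussian M X"
  shows "integrable M (\<lambda>\<omega>. cmod (X \<omega>) ^ 4)" and "expectation (\<lambda>\<omega>. cmod (X \<omega>) ^ 4) = 2"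
proof -
  have ind: "indep_var borel (\<lambda>\<omega>. Re (X \<omega>)) borel (\<lambda>\<omega>. Im (X \<omega>))"
    and re: "distributed M lborel (\<lambda>\<omega>. Re (X \<omega>)) (normal_density 0 (sqrt (1 / 2)))"
    and im: "distributed M lborel (\<lambda>\<omega>. Im (X \<omega>)) (normal_density 0 (sqrt (1 / 2)))"
    using X by (auto simp: std_complex_gaussian_def)
  have m2: "integrable M (\<lambda>\<omega>. (Re (X \<omega>))\<^sup>2)" "expectation (\<lambda>\<omega>. (Re (X \<omega>))\<^sup>2) = 1 / 2"
       "integrable M (\<lambda>\<omega>. (Im (X \<omega>))\<^sup>2)" "expectation (\<lambda>\<omega>. (Im (X \<omega>))\<^sup>2) = 1 / 2"
    using normal_moment_even_expectation[OF re, of 1] normal_moment_even_expectation[OF im, of 1]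
    by (auto simp: power_divide fact_numeral)
  have m4: "integrable M (\<lambda>\<omega>. Re (X \<omega>) ^ 4)" "expectation (\<lambda>\<omega>. Re (X \<omega>) ^ 4) = 3 / 4"
       "integrable M (\<lambda>\<omega>. Im (X \<omega>) ^ 4)" "expectation (\<lambda>\<omega>. Im (X \<omega>) ^ 4) = 3 / 4"
    using normal_moment_even_expectation[OF re, of 2] normal_moment_even_expectation[OF im, of 2]
    by (auto simp: power_divide fact_numeral)
  have ind2: "indep_var borel (\<lambda>\<omega>. (Re (X \<omega>))\<^sup>2) borel (\<lambda>\<omega>. (Im (X \<omega>))\<^sup>2)"
    using indep_var_compose[OF ind, of "\<lambda>x. x\<^sup>2" borel "\<lambda>x. x\<^sup>2" borel] by (simp add: comp_def)
  have mix: "integrable M (\<lambda>\<omega>. (Re (X \<omega>))\<^sup>2 * (Im (X \<omega>))\<^sup>2)"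
      "expectation (\<lambda>\<omega>. (Re (X \<omega>))\<^sup>2 * (Im (X \<omega>))\<^sup>2) = 1 / 4"
    using indep_var_integrable[OF ind2] indep_var_lebesgue_integral[OF ind2] m2 by auto
  \<comment> \<open>With this expansion the fourth moment is 3/4 + 2 * 1/4 + 3/4.\<close>
  have eq: "cmod z ^ 4 = Re z ^ 4 + 2 * ((Re z)\<^sup>2 * (Im z)\<^sup>2) + Im z ^ 4" for z
  proof -
    have "cmod z ^ 4 = ((cmod z)\<^sup>2)\<^sup>2" by simp
    then show ?thesis unfolding cmod_power2 by (simp add: power2_sum)
  qed
  show "integrable M (\<lambda>\<omega>. cmod (X \<omega>) ^ 4)" "expectation (\<lambda>\<omega>. cmod (X \<omega>) ^ 4) = 2"
    using mix m4 unfolding eq by auto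
qed

section \<open>Moments of the modulus of a linear combination\<close>

context prob_space
begin

context
  fixes I :: "'i set" and X :: "'i \<Rightarrow> 'a \<Rightarrow> complex" and c :: "'i \<Rightarrow> complex"
  assumes I: "finite I" "I \<noteq> {}" and ind: "indep_vars (\<lambda>_. borel) X I"
    and X: "\<And>i. i \<in> I \<Longrightarrow> std_complex_gaussian M (X i)"
    and c: "\<And>i. i \<in> I \<Longrightarrow> c i \<noteq> 0"
begin

lemma measurable_sum_std_complex_gaussian [measurable]:
  "(\<lambda>\<omega>. \<Sum>j\<in>I. c j * X j \<omega>) \<in> borel_measurable M"
proof -
  have [measurable]: "X i \<in> borel_measurable M" if "i \<in> I" for i
    using ind that by (auto simp: indep_vars_def)
  show ?thesis by measurable
qed

lemma sum_cmod2_pos: "(\<Sum>j\<in>I. (cmod (c j))\<^sup>2) > 0"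
  using I c by (intro sum_pos) auto

text \<open>The real part has a density and so avoids 0 almost surely. This later disposes of the
  event on which the optimal phase is a quotient by zero.\<close>

lemma AE_sum_std_complex_gaussian_nonzero:
  "AE \<omega> in M. (\<Sum>j\<in>I. c j * X j \<omega>) \<noteq> 0"
proof -
  note D = normal_Re_sum_std_complex_gaussian[OF I ind X c]
  have "AE x in lborel. 0 < ennreal (normal_density 0 (sqrt ((\<Sum>i\<in>I. (cmod (c i))\<^sup>2) / 2)) x) \<longrightarrow> x \<noteq> 0"
    using AE_lborel_singleton[of "0 :: real"] by eventually_elim simp
  then have "AE \<omega> in M. Re (\<Sum>j\<in>I. c j * X j \<omega>) \<noteq> 0"
    using distributed_AE2[OF D, where P = "\<lambda>x. x \<noteq> 0"] by simp
  then show ?thesis by eventually_elim (metis zero_complex.simps(1))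
qed

lemma cmod_sum_std_complex_gaussian:
  "integrable M (\<lambda>\<omega>. cmod (\<Sum>j\<in>I. c j * X j \<omega>))"
  "expectation (\<lambda>\<omega>. cmod (\<Sum>j\<in>I. c j * X j \<omega>)) = sqrt pi / 2 * sqrt (\<Sum>j\<in>I. (cmod (c j))\<^sup>2)"
proof -
  have "has_bochner_integral M (\<lambda>\<omega>. cmod (\<Sum>j\<in>I. c j * X j \<omega>))
      (sqrt pi / 2 * sqrt (\<Sum>j\<in>I. (cmod (c j))\<^sup>2))"
    using nn_integral_cmod_sum_std_complex_gaussian[OF I ind X c]
    by (intro has_bochner_integral_nn_integral) (auto intro!: sum_nonneg mult_nonneg_nonneg)
  then show "integrable M (\<lambda>\<omega>. cmod (\<Sum>j\<in>I. c j * X j \<omega>))"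
    "expectation (\<lambda>\<omega>. cmod (\<Sum>j\<in>I. c j * X j \<omega>)) = sqrt pi / 2 * sqrt (\<Sum>j\<in>I. (cmod (c j))\<^sup>2)"
    by (auto simp: has_bochner_integral_iff)
qed

lemma cmod2_sum_std_complex_gaussian:
  "integrable M (\<lambda>\<omega>. (cmod (\<Sum>j\<in>I. c j * X j \<omega>))\<^sup>2)"
  "expectation (\<lambda>\<omega>. (cmod (\<Sum>j\<in>I. c j * X j \<omega>))\<^sup>2) = (\<Sum>j\<in>I. (cmod (c j))\<^sup>2)"
proof -
  let ?Z = "\<lambda>\<omega>. \<Sum>j\<in>I. c j * X j \<omega>" and ?Q = "\<Sum>j\<in>I. (cmod (c j))\<^sup>2"
  have *: "distributed M lborel (\<lambda>\<omega>. Re (\<Sum>j\<in>I. d * c j * X j \<omega>))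
      (normal_density 0 (sqrt ((\<Sum>j\<in>I. (cmod (d * c j))\<^sup>2) / 2)))" if "d \<noteq> 0" for d
    using I ind X c that by (intro normal_Re_sum_std_complex_gaussian) auto
  have re: "distributed M lborel (\<lambda>\<omega>. Re (?Z \<omega>)) (normal_density 0 (sqrt (?Q / 2)))"
    using *[of 1] by simp
  \<comment> \<open>The imaginary part is the real part after multiplication by
    \<open>- \<i>\<close>, so it is normal with the same variance.\<close>
  have "(\<Sum>j\<in>I. - \<i> * c j * X j \<omega>) = - \<i> * ?Z \<omega>" for \<omega>
    by (simp add: sum_distrib_left mult.assoc sum_negf)
  then have im: "distributed M lborel (\<lambda>\<omega>. Im (?Z \<omega>)) (normal_density 0 (sqrt (?Q / 2)))"
    using *[of "- \<i>"] by (simp add: norm_mult del: Re_sum Im_sum)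
  show "integrable M (\<lambda>\<omega>. (cmod (?Z \<omega>))\<^sup>2)" "expectation (\<lambda>\<omega>. (cmod (?Z \<omega>))\<^sup>2) = ?Q"
    using normal_moment_even_expectation[OF re, of 1] normal_moment_even_expectation[OF im, of 1]
      sum_cmod2_pos unfolding cmod_power2 by (auto simp: fact_numeral simp del: Re_sum Im_sum)
qed

text \<open>The expectation below is minus the derivative at \<open>h = 0\<close> of the function of \<open>h\<close> in
  \<open>nn_integral_exp_cmod_sum_std_complex_gaussian\<close>; dominated convergence justifies the limit.\<close>

lemma cmod2_mult_cmod_sum_std_complex_gaussian:
  assumes i: "i \<in> I"
  defines "Q \<equiv> (\<Sum>j\<in>I. (cmod (c j))\<^sup>2)"
  shows "integrable M (\<lambda>\<omega>. (cmod (X i \<omega>))\<^sup>2 * cmod (\<Sum>j\<in>I. c j * X j \<omega>))"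
    and "expectation (\<lambda>\<omega>. (cmod (X i \<omega>))\<^sup>2 * cmod (\<Sum>j\<in>I. c j * X j \<omega>))
      = sqrt pi / 2 * (sqrt Q + (cmod (c i))\<^sup>2 / (2 * sqrt Q))"
proof -
  let ?Z = "\<lambda>\<omega>. cmod (\<Sum>j\<in>I. c j * X j \<omega>)" and ?S = "\<lambda>\<omega>. (cmod (X i \<omega>))\<^sup>2"
  define q R where "q = (cmod (c i))\<^sup>2" and "R = (\<Sum>j\<in>I - {i}. (cmod (c j))\<^sup>2)"
  have QR: "Q = R + q" using I i by (simp add: Q_def R_def q_def sum.remove[of I i])
  have Q: "Q > 0" using sum_cmod2_pos by (simp add: Q_def)
  have [measurable]: "X i \<in> borel_measurable M"
    using ind i by (auto simp: indep_vars_def)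
  \<comment> \<open>This bounds the mixed product by a fourth power of
    \<open>cmod (X i \<omega>)\<close> plus a square of the modulus of the sum, both
    integrable.\<close>
  have le: "a\<^sup>2 * b \<le> a ^ 4 + b\<^sup>2" for a b :: real
  proof -
    have "2 * (a\<^sup>2 * b) \<le> (a\<^sup>2)\<^sup>2 + b\<^sup>2"
      using sum_squares_bound[of "a\<^sup>2" b] by (simp only: mult.assoc)
    moreover have "0 \<le> (a\<^sup>2)\<^sup>2 + b\<^sup>2" by simp
    moreover have "(a\<^sup>2)\<^sup>2 = a ^ 4" by simp
    ultimately show ?thesis by linarith
  qed
  show int: "integrable M (\<lambda>\<omega>. ?S \<omega> * ?Z \<omega>)"
    by (rule Bochner_Integration.integrable_bound[OF Bochner_Integration.integrable_add[OF
            std_complex_gaussian_cmod_power4(1)[OF X[OF i]] cmod2_sum_std_complex_gaussian(1)]])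
      (auto intro!: le)
  define g where "g = (\<lambda>h. 1 / (1 + h) * (sqrt pi / 2 * sqrt (R + q / (1 + h))))"
  \<comment> \<open>The weighted expectations are known for \<open>h \<ge> 0\<close> only, so 0 is
    approached from above, along a sequence to suit dominated convergence; \<open>Suc\<close> keeps
    every term positive.\<close>
  define hh where "hh = (\<lambda>n. inverse (real (Suc n)))"
  have hh: "hh n > 0" for n by (simp add: hh_def)
  have at0: "filterlim hh (at 0) sequentially"
    unfolding hh_def filterlim_at using LIMSEQ_inverse_real_of_nat by auto
  have E: "has_bochner_integral M (\<lambda>\<omega>. exp (- h * ?S \<omega>) * ?Z \<omega>) (g h)" if "h \<ge> 0" for h
  proof (rule has_bochner_integral_nn_integral)
    show "0 \<le> g h"
      unfolding g_def R_def q_def using that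
      by (intro mult_nonneg_nonneg real_sqrt_ge_zero add_nonneg_nonneg sum_nonneg
          divide_nonneg_nonneg) auto
    show "(\<integral>\<^sup>+\<omega>. ennreal (exp (- h * ?S \<omega>) * ?Z \<omega>) \<partial>M) = ennreal (g h)"
      unfolding g_def R_def q_def
      by (rule nn_integral_exp_cmod_sum_std_complex_gaussian[OF I(1) i ind X c that])
  qed auto
  have D: "expectation (\<lambda>\<omega>. (1 - exp (- hh n * ?S \<omega>)) / hh n * ?Z \<omega>) = - ((g (hh n) - g 0) / hh n)" for n
  proof -
    have "has_bochner_integral M (\<lambda>\<omega>. (exp (- 0 * ?S \<omega>) * ?Z \<omega> - exp (- hh n * ?S \<omega>) * ?Z \<omega>) / hh n)
        ((g 0 - g (hh n)) / hh n)"
      using hh[of n] by (intro has_bochner_integral_divide_zero has_bochner_integral_diff E) auto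
    moreover have "(exp (- 0 * ?S \<omega>) * ?Z \<omega> - exp (- hh n * ?S \<omega>) * ?Z \<omega>) / hh n
        = (1 - exp (- hh n * ?S \<omega>)) / hh n * ?Z \<omega>" for \<omega>
      by (simp add: left_diff_distrib)
    ultimately show ?thesis
      by (simp only: has_bochner_integral_integral_eq minus_divide_left minus_diff_eq)
  qed
  have "(\<lambda>n. expectation (\<lambda>\<omega>. (1 - exp (- hh n * ?S \<omega>)) / hh n * ?Z \<omega>))
      \<longlonglongrightarrow> expectation (\<lambda>\<omega>. ?S \<omega> * ?Z \<omega>)"
  proof (rule integral_dominated_convergence[where w = "\<lambda>\<omega>. ?S \<omega> * ?Z \<omega>"])
    show "AE \<omega> in M. (\<lambda>n. (1 - exp (- hh n * ?S \<omega>)) / hh n * ?Z \<omega>) \<longlonglongrightarrow> ?S \<omega> * ?Z \<omega>"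
    proof (intro AE_I2 tendsto_mult tendsto_const)
      fix \<omega>
      have "((\<lambda>h. 1 - exp (- h * ?S \<omega>)) has_real_derivative ?S \<omega>) (at 0)"
        by (auto intro!: derivative_eq_intros)
      then have "((\<lambda>h. (1 - exp (- h * ?S \<omega>)) / h) \<longlongrightarrow> ?S \<omega>) (at 0)"
        by (simp add: has_field_derivative_iff)
      then show "(\<lambda>n. (1 - exp (- hh n * ?S \<omega>)) / hh n) \<longlonglongrightarrow> ?S \<omega>"
        by (rule filterlim_compose[OF _ at0])
    qed
    \<comment> \<open>Since \<open>1 - exp (- x)\<close> lies between 0 and \<open>x\<close> for
      \<open>x \<ge> 0\<close>, every difference quotient is dominated by its limit.\<close>
    show "AE \<omega> in M. norm ((1 - exp (- hh n * ?S \<omega>)) / hh n * ?Z \<omega>) \<le> ?S \<omega> * ?Z \<omega>" for n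
    proof (rule AE_I2)
      fix \<omega>
      have "exp (- hh n * ?S \<omega>) \<le> 1" using hh[of n] by simp
      moreover have "1 - exp (- hh n * ?S \<omega>) \<le> hh n * ?S \<omega>"
        using exp_ge_add_one_self[of "- hh n * ?S \<omega>"] by simp
      ultimately have "\<bar>(1 - exp (- hh n * ?S \<omega>)) / hh n\<bar> \<le> ?S \<omega>"
        using hh[of n] by (simp add: abs_of_nonneg divide_le_eq mult.commute)
      then show "norm ((1 - exp (- hh n * ?S \<omega>)) / hh n * ?Z \<omega>) \<le> ?S \<omega> * ?Z \<omega>"
        unfolding real_norm_def abs_mult abs_norm_cancel by (rule mult_right_mono) simp
    qed
  qed (use int in auto)
  moreover have "(\<lambda>n. - ((g (hh n) - g 0) / hh n)) \<longlonglongrightarrow> sqrt pi / 2 * (sqrt Q + q / (2 * sqrt Q))"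
  proof -
    \<comment> \<open>In the derivative, \<open>sqrt Q\<close> comes from the prefactor
      \<open>1 / (1 + h)\<close> and \<open>q / (2 * sqrt Q)\<close> from the square root, using
      \<open>R + q = Q\<close>.\<close>
    have "(g has_real_derivative - (sqrt pi / 2 * (sqrt Q + q / (2 * sqrt Q)))) (at 0)"
      unfolding g_def using Q by (auto intro!: derivative_eq_intros simp: QR field_simps)
    then have "((\<lambda>h. (g h - g 0) / h) \<longlongrightarrow> - (sqrt pi / 2 * (sqrt Q + q / (2 * sqrt Q)))) (at 0)"
      by (simp add: has_field_derivative_iff)
    then have "(\<lambda>n. (g (hh n) - g 0) / hh n) \<longlonglongrightarrow> - (sqrt pi / 2 * (sqrt Q + q / (2 * sqrt Q)))"
      by (rule filterlim_compose[OF _ at0])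
    from tendsto_minus[OF this] show ?thesis by simp
  qed
  ultimately show "expectation (\<lambda>\<omega>. ?S \<omega> * ?Z \<omega>) = sqrt pi / 2 * (sqrt Q + (cmod (c i))\<^sup>2 / (2 * sqrt Q))"
    unfolding D q_def by (rule LIMSEQ_unique)
qed

end

end

lemma (in prob_space) std_complex_gaussian_cmod_moments:
  assumes X: "std_complex_gaussian M X" and k: "k \<in> {1, 2, 3, 4}"
  shows "integrable M (\<lambda>\<omega>. cmod (X \<omega>) ^ k)"
    and "expectation (\<lambda>\<omega>. cmod (X \<omega>) ^ k) = [sqrt pi / 2, 1, 3 / 4 * sqrt pi, 2] ! (k - 1)"
proof -
  have [measurable]: "(\<lambda>\<omega>. Re (X \<omega>)) \<in> borel_measurable M" "(\<lambda>\<omega>. Im (X \<omega>)) \<in> borel_measurable M"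
    using X by (auto simp: std_complex_gaussian_def distributed_def)
  have [measurable]: "X \<in> borel_measurable M"
    by (subst borel_measurable_complex_iff) auto
  \<comment> \<open>A single variable is treated as a family over a one-point index set with
    coefficient 1. The mixed moment then gives the third moment,
    \<open>sqrt pi / 2 * (1 + 1 / 2)\<close>.\<close>
  have ind: "indep_vars (\<lambda>_. borel) (\<lambda>_. X) {()}"
    by (auto simp: indep_vars_def2 indep_sets_def subset_singleton_iff)
  note m = cmod_sum_std_complex_gaussian[OF _ _ ind, of "\<lambda>_. 1"]
    cmod2_sum_std_complex_gaussian[OF _ _ ind, of "\<lambda>_. 1"]
    cmod2_mult_cmod_sum_std_complex_gaussian[OF _ _ ind, of "\<lambda>_. 1" "()"]
    std_complex_gaussian_cmod_power4[OF X]
  show "integrable M (\<lambda>\<omega>. cmod (X \<omega>) ^ k)"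
    "expectation (\<lambda>\<omega>. cmod (X \<omega>) ^ k) = [sqrt pi / 2, 1, 3 / 4 * sqrt pi, 2] ! (k - 1)"
    using m X k by (auto simp: power3_eq_cube power2_eq_square field_simps)
qed

section \<open>Moments of sums of independent variables\<close>

lemma (in prob_space) indep_var_add_power:
  fixes U V :: "'a \<Rightarrow> real"
  assumes ind: "indep_var borel U borel V"
    and int: "\<And>j. j \<le> k \<Longrightarrow> integrable M (\<lambda>\<omega>. U \<omega> ^ j)" "\<And>j. j \<le> k \<Longrightarrow> integrable M (\<lambda>\<omega>. V \<omega> ^ j)"
  shows "integrable M (\<lambda>\<omega>. (U \<omega> + V \<omega>) ^ k)"
    and "expectation (\<lambda>\<omega>. (U \<omega> + V \<omega>) ^ k) =
      (\<Sum>j\<le>k. real (k choose j) * (expectation (\<lambda>\<omega>. U \<omega> ^ j) * expectation (\<lambda>\<omega>. V \<omega> ^ (k - j))))"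
proof -
  have ind': "indep_var borel (\<lambda>\<omega>. U \<omega> ^ i) borel (\<lambda>\<omega>. V \<omega> ^ j)" for i j
    using indep_var_compose[OF ind, of "\<lambda>x. x ^ i" borel "\<lambda>x. x ^ j" borel] by (simp add: comp_def)
  have 1: "integrable M (\<lambda>\<omega>. U \<omega> ^ j * V \<omega> ^ (k - j))"
    "expectation (\<lambda>\<omega>. U \<omega> ^ j * V \<omega> ^ (k - j)) = expectation (\<lambda>\<omega>. U \<omega> ^ j) * expectation (\<lambda>\<omega>. V \<omega> ^ (k - j))"
    if "j \<le> k" for j
    using that int by (auto intro!: indep_var_integrable indep_var_lebesgue_integral ind')
  show "integrable M (\<lambda>\<omega>. (U \<omega> + V \<omega>) ^ k)"
    unfolding binomial_ring mult.assoc using 1 by auto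
  show "expectation (\<lambda>\<omega>. (U \<omega> + V \<omega>) ^ k) =
      (\<Sum>j\<le>k. real (k choose j) * (expectation (\<lambda>\<omega>. U \<omega> ^ j) * expectation (\<lambda>\<omega>. V \<omega> ^ (k - j))))"
    unfolding binomial_ring mult.assoc using 1
    by (subst Bochner_Integration.integral_sum) (auto intro!: sum.cong)
qed

text \<open>The \<open>k\<close>-th moment of a sum of \<open>n\<close> independent variables whose \<open>j\<close>-th moments are all \<open>m j\<close>.\<close>

primrec iid_sum_moment :: "(nat \<Rightarrow> real) \<Rightarrow> nat \<Rightarrow> nat \<Rightarrow> real" where
  "iid_sum_moment m 0 k = 0 ^ k"
| "iid_sum_moment m (Suc n) k = (\<Sum>j\<le>k. real (k choose j) * (m j * iid_sum_moment m n (k - j)))"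

text \<open>One variable is split off at a time by the binomial theorem. As this involves all lower
  moments of the remaining sum, the induction carries every order up to \<open>K\<close>
  together.\<close>

lemma (in prob_space) sum_indep_power:
  fixes X :: "'i \<Rightarrow> 'a \<Rightarrow> real"
  assumes "finite I" "indep_vars (\<lambda>_. borel) X I"
    and "\<And>i k. i \<in> I \<Longrightarrow> k \<le> K \<Longrightarrow> integrable M (\<lambda>\<omega>. X i \<omega> ^ k)"
    and "\<And>i k. i \<in> I \<Longrightarrow> k \<le> K \<Longrightarrow> expectation (\<lambda>\<omega>. X i \<omega> ^ k) = m k"
    and "k \<le> K"
  shows "integrable M (\<lambda>\<omega>. (\<Sum>i\<in>I. X i \<omega>) ^ k)
    \<and> expectation (\<lambda>\<omega>. (\<Sum>i\<in>I. X i \<omega>) ^ k) = iid_sum_moment m (card I) k"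
  using assms
proof (induction I arbitrary: k rule: finite_induct)
  case empty
  then show ?case by (simp add: prob_space)
next
  case (insert i I)
  have "indep_vars (\<lambda>_. borel) X I"
    by (rule indep_vars_subset[OF insert.prems(1)]) auto
  with insert have IH: "integrable M (\<lambda>\<omega>. (\<Sum>i\<in>I. X i \<omega>) ^ j)"
    "expectation (\<lambda>\<omega>. (\<Sum>i\<in>I. X i \<omega>) ^ j) = iid_sum_moment m (card I) j" if "j \<le> K" for j
    using that by auto
  have ind: "indep_var borel (X i) borel (\<lambda>\<omega>. \<Sum>i\<in>I. X i \<omega>)"
    using insert by (intro indep_vars_sum) auto
  show ?case
    using indep_var_add_power[OF ind, of k] insert.hyps insert.prems IH by auto
qed

lemma iid_sum_moment_0:
  assumes "m 0 = 1"
  shows "iid_sum_moment m n 0 = 1"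
  by (induction n) (use assms in auto)

lemma iid_sum_moment_1:
  assumes "m 0 = 1"
  shows "iid_sum_moment m n (Suc 0) = n * m 1"
  by (induction n) (use assms in \<open>auto simp: iid_sum_moment_0 algebra_simps\<close>)

lemma iid_sum_moment_2:
  assumes "m 0 = 1"
  shows "iid_sum_moment m n 2 = n * m 2 + n * (n - 1) * (m 1)\<^sup>2"
  by (induction n)
    (use assms in \<open>auto simp: iid_sum_moment_0 iid_sum_moment_1 numeral_eq_Suc algebra_simps\<close>)

lemma iid_sum_moment_3:
  assumes "m 0 = 1"
  shows "iid_sum_moment m n 3 =
    n * m 3 + 3 * n * (n - 1) * m 2 * m 1 + n * (real n - 1) * (real n - 2) * m 1 ^ 3"
proof (induction n)
  case (Suc n)
  have "iid_sum_moment m (Suc n) 3 =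
      iid_sum_moment m n 3 + 3 * m 1 * iid_sum_moment m n 2 + 3 * m 2 * iid_sum_moment m n (Suc 0) + m 3"
    using assms by (simp add: numeral_eq_Suc iid_sum_moment_0)
  then show ?case
    unfolding Suc iid_sum_moment_2[where m = m, OF assms] iid_sum_moment_1[where m = m, OF assms]
    by (simp add: power2_eq_square power3_eq_cube algebra_simps)
qed simp

text \<open>The terms correspond to the ways in which the four factors can share summands: 1, 4, 3,
  6 and 1 count the set partitions of type 4, 3+1, 2+2, 2+1+1 and 1+1+1+1, and the number of blocks
  fixes the falling factorial in \<open>n\<close>.\<close>

lemma iid_sum_moment_4:
  assumes "m 0 = 1"
  shows "iid_sum_moment m n 4 = n * m 4 + 4 * n * (n - 1) * m 3 * m 1 + 3 * n * (n - 1) * (m 2)\<^sup>2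
    + 6 * n * (real n - 1) * (real n - 2) * m 2 * (m 1)\<^sup>2
    + n * (real n - 1) * (real n - 2) * (real n - 3) * m 1 ^ 4"
proof (induction n)
  case (Suc n)
  have "iid_sum_moment m (Suc n) 4 =
      iid_sum_moment m n 4 + 4 * m 1 * iid_sum_moment m n 3 + 6 * m 2 * iid_sum_moment m n 2
      + 4 * m 3 * iid_sum_moment m n (Suc 0) + m 4"
    using assms by (simp add: numeral_eq_Suc iid_sum_moment_0)
  then show ?case
    unfolding Suc iid_sum_moment_3[where m = m, OF assms] iid_sum_moment_2[where m = m, OF assms]
      iid_sum_moment_1[where m = m, OF assms]
    by (simp add: power2_eq_square power3_eq_cube power4_eq_xxxx algebra_simps)
qed simp

section \<open>The optimal SNR\<close>

text \<open>Events determined by \<open>f (U \<omega>)\<close> or \<open>g (V \<omega>)\<close> are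
  among those determined by \<open>U\<close> or \<open>V\<close>, and subfamilies of independent
  families are independent. Closure under intersection carries this over to the generated
  sigma-algebras.\<close>

lemma (in prob_space) indep_rv_compose:
  assumes UV: "indep_rv M U V"
    and [measurable]: "f \<in> borel_measurable borel" "g \<in> borel_measurable borel"
  shows "indep_var borel (\<lambda>\<omega>. f (U \<omega>)) borel (\<lambda>\<omega>. g (V \<omega>))"
proof -
  have [measurable]: "U \<in> borel_measurable M" "V \<in> borel_measurable M"
    and ind: "indep_set {U -` A \<inter> space M |A. A \<in> sets borel} {V -` B \<inter> space M |B. B \<in> sets borel}"
    using UV by (auto simp: indep_rv_def)
  have stable: "Int_stable {h -` A \<inter> space M |A. A \<in> sets borel}" for h :: "'a \<Rightarrow> 'e::topological_space"
    unfolding Int_stable_def by (auto, rule_tac x = "A \<inter> Aa" in exI) auto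
  have mono: "indep_set A' B'" if "indep_set A B" "A' \<subseteq> A" "B' \<subseteq> B" for A A' B B'
    using that unfolding indep_sets2_eq by (meson subset_iff)
  have "indep_set {(\<lambda>\<omega>. f (U \<omega>)) -` A \<inter> space M |A. A \<in> sets borel}
      {(\<lambda>\<omega>. g (V \<omega>)) -` A \<inter> space M |A. A \<in> sets borel}"
    using measurable_sets_borel[of f borel] measurable_sets_borel[of g borel]
    by (intro mono[OF ind]) (auto simp: vimage_def)
  from indep_set_sigma_sets[OF this stable stable] show ?thesis
    unfolding indep_var_eq by simp
qed

text \<open>The phase rotates the reflected path into alignment with the direct one, so the cross
  term in the squared norm becomes the nonnegative product of \<open>cmod (herm ab u)\<close> and
  \<open>Y\<close>. Unit-modulus steering entries make the reflected power the same at every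
  antenna, whence the factor \<open>CARD('m)\<close>.\<close>

lemma optimal_snr_eq:
  fixes ab u :: "complex ^ 'm" and ar v :: "complex ^ 'n"
  assumes ab: "\<And>i. cmod (ab $ i) = 1" and ar: "\<And>n. cmod (ar $ n) = 1"
    and pos: "\<beta>d > 0" "\<beta>br > 0" "\<beta>ru > 0"
  defines "Y \<equiv> \<Sum>n\<in>UNIV. cmod (v $ n)"
  shows "optimal_snr \<beta>d \<beta>br \<beta>ru \<tau> ab ar u v =
    (\<beta>d * (norm u)\<^sup>2 + 2 * sqrt (\<beta>d * \<beta>br * \<beta>ru) * (cmod (herm ab u) * Y)
      + \<beta>br * \<beta>ru * real CARD('m) * (if herm ab u = 0 then 0 else Y\<^sup>2)) * \<tau>"
proof -
  define Z where "Z = herm ab u"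
  define p where "p = bs_phase ab (sqrt \<beta>d *\<^sub>R u)"
  define k where "k = of_real (sqrt (\<beta>br * \<beta>ru)) * p * of_real Y"
  have "herm ab (sqrt \<beta>d *\<^sub>R u) = of_real (sqrt \<beta>d) * Z"
    by (simp add: herm_def Z_def sum_distrib_left scaleR_conv_of_real[where 'a = complex] mult.left_commute)
  then have p: "p = Z / of_real (cmod Z)"
    using pos by (simp add: p_def bs_phase_def norm_mult)
  have pZ: "p * cnj Z = of_real (cmod Z)"
    by (simp add: p flip: complex_norm_square) (simp add: power2_eq_square)
  \<comment> \<open>For \<open>Z = 0\<close> the phase is the quotient 0 / 0, which equals 0, so the
    reflected path disappears instead of having a phase of modulus 1.\<close>
  have p2: "(cmod p)\<^sup>2 = (if Z = 0 then 0 else 1)"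
    by (simp add: p norm_divide)
  have expand: "(cmod (a + b))\<^sup>2 = (cmod a)\<^sup>2 + 2 * Re (b * cnj a) + (cmod b)\<^sup>2" for a b
    unfolding cmod_power2 by (simp add: power2_eq_square algebra_simps)
  have "Re (herm (sqrt \<beta>d *\<^sub>R u + k *s ab) (sqrt \<beta>d *\<^sub>R u + k *s ab))
      = (\<Sum>i\<in>UNIV. (cmod (of_real (sqrt \<beta>d) * u $ i + k * ab $ i))\<^sup>2)"
  proof -
    have Re_cnj_mult: "Re (cnj z * z) = (cmod z)\<^sup>2" for z
      unfolding cmod_power2 by (simp add: power2_eq_square)
    show ?thesis
      unfolding herm_def Re_sum Re_cnj_mult by (simp add: scaleR_conv_of_real[where 'a = complex])
  qed
  also have "\<dots> = (\<Sum>i\<in>UNIV. \<beta>d * (cmod (u $ i))\<^sup>2 + 2 * sqrt \<beta>d * Re (k * cnj (cnj (ab $ i) * u $ i)) + (cmod k)\<^sup>2)"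
  proof (rule sum.cong)
    fix i
    have Re_of_real_mult: "Re (of_real a * z) = a * Re z" for a z
      by simp
    have "k * ab $ i * cnj (of_real (sqrt \<beta>d) * u $ i) = of_real (sqrt \<beta>d) * (k * cnj (cnj (ab $ i) * u $ i))"
      by simp
    then have "2 * Re (k * ab $ i * cnj (of_real (sqrt \<beta>d) * u $ i)) = 2 * sqrt \<beta>d * Re (k * cnj (cnj (ab $ i) * u $ i))"
      by (simp only: Re_of_real_mult mult.assoc)
    then show "(cmod (of_real (sqrt \<beta>d) * u $ i + k * ab $ i))\<^sup>2 =
        \<beta>d * (cmod (u $ i))\<^sup>2 + 2 * sqrt \<beta>d * Re (k * cnj (cnj (ab $ i) * u $ i)) + (cmod k)\<^sup>2"
      unfolding expand using pos ab[of i] by (simp only: norm_mult norm_of_real power_mult_distrib real_sqrt_pow2 power2_abs order_less_imp_le) simp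
  qed simp
  also have "\<dots> = \<beta>d * (norm u)\<^sup>2 + 2 * sqrt \<beta>d * Re (k * cnj Z) + real CARD('m) * (cmod k)\<^sup>2"
  proof -
    have "(\<Sum>i\<in>UNIV. 2 * sqrt \<beta>d * Re (k * cnj (cnj (ab $ i) * u $ i))) = 2 * sqrt \<beta>d * Re (k * cnj Z)"
      by (simp only: Z_def herm_def cnj_sum sum_distrib_left Re_sum)
    moreover have "(norm u)\<^sup>2 = (\<Sum>i\<in>UNIV. (cmod (u $ i))\<^sup>2)"
      by (simp add: norm_vec_def L2_set_def sum_nonneg)
    ultimately show ?thesis
      by (simp only: sum.distrib sum_distrib_left sum_constant)
  qed
  also have "k * cnj Z = of_real (sqrt (\<beta>br * \<beta>ru) * (cmod Z * Y))"
    using pZ by (simp add: k_def mult.assoc mult.left_commute mult.commute)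
  also have "(cmod k)\<^sup>2 = \<beta>br * \<beta>ru * (if Z = 0 then 0 else Y\<^sup>2)"
    using pos by (simp add: k_def norm_mult power_mult_distrib p2)
  finally have "Re (herm (sqrt \<beta>d *\<^sub>R u + k *s ab) (sqrt \<beta>d *\<^sub>R u + k *s ab)) =
      \<beta>d * (norm u)\<^sup>2 + 2 * sqrt (\<beta>d * \<beta>br * \<beta>ru) * (cmod Z * Y)
      + \<beta>br * \<beta>ru * real CARD('m) * (if Z = 0 then 0 else Y\<^sup>2)"
    by (simp add: real_sqrt_mult)
  then show ?thesis
    using ar pos by (simp add: optimal_snr_def global_channel_eq Let_def k_def p_def Y_def Z_def)
qed

lemma powr_three_halves: "x \<ge> 0 \<Longrightarrow> x powr (3 / 2) = sqrt x ^ 3" for x :: real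
  by (cases "x = 0") (simp_all add: powr_half_sqrt[symmetric] powr_powr flip: powr_numeral)

section \<open>Moments of the direct channel and of the sum over the RIS elements\<close>

lemma (in prob_space) norm_and_herm_moments:
  fixes a :: "complex ^ 'm" and u :: "'a \<Rightarrow> complex ^ 'm"
  assumes u: "std_complex_gaussian_vec M u" and a: "\<And>i. cmod (a $ i) = 1"
  defines "m \<equiv> real CARD('m)"
  shows "AE \<omega> in M. herm a (u \<omega>) \<noteq> 0"
    and "integrable M (\<lambda>\<omega>. (norm (u \<omega>))\<^sup>2)" "expectation (\<lambda>\<omega>. (norm (u \<omega>))\<^sup>2) = m"
    and "integrable M (\<lambda>\<omega>. ((norm (u \<omega>))\<^sup>2)\<^sup>2)" "expectation (\<lambda>\<omega>. ((norm (u \<omega>))\<^sup>2)\<^sup>2) = m\<^sup>2 + m"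
    and "integrable M (\<lambda>\<omega>. cmod (herm a (u \<omega>)))"
      "expectation (\<lambda>\<omega>. cmod (herm a (u \<omega>))) = sqrt pi / 2 * sqrt m"
    and "integrable M (\<lambda>\<omega>. (cmod (herm a (u \<omega>)))\<^sup>2)" "expectation (\<lambda>\<omega>. (cmod (herm a (u \<omega>)))\<^sup>2) = m"
    and "integrable M (\<lambda>\<omega>. (norm (u \<omega>))\<^sup>2 * cmod (herm a (u \<omega>)))"
      "expectation (\<lambda>\<omega>. (norm (u \<omega>))\<^sup>2 * cmod (herm a (u \<omega>))) = sqrt pi / 2 * sqrt m * (m + 1 / 2)"
proof -
  have ind: "indep_vars (\<lambda>_. borel) (\<lambda>i \<omega>. u \<omega> $ i) UNIV"
    and g: "\<And>i. std_complex_gaussian M (\<lambda>\<omega>. u \<omega> $ i)"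
    using u by (auto simp: std_complex_gaussian_vec_def)
  have c: "cnj (a $ i) \<noteq> 0" for i
    using a[of i] by auto
  have sum_c: "(\<Sum>i\<in>UNIV. (cmod (cnj (a $ i)))\<^sup>2) = m"
    using a by (simp add: m_def)
  let ?c = "\<lambda>i. cnj (a $ i)"
  show "AE \<omega> in M. herm a (u \<omega>) \<noteq> 0"
    using AE_sum_std_complex_gaussian_nonzero[where c = ?c, OF _ _ ind g c] by (simp add: herm_def)
  show "integrable M (\<lambda>\<omega>. cmod (herm a (u \<omega>)))"
      "expectation (\<lambda>\<omega>. cmod (herm a (u \<omega>))) = sqrt pi / 2 * sqrt m"
    using cmod_sum_std_complex_gaussian[where c = ?c, OF _ _ ind g c] unfolding herm_def sum_c by auto
  show "integrable M (\<lambda>\<omega>. (cmod (herm a (u \<omega>)))\<^sup>2)" "expectation (\<lambda>\<omega>. (cmod (herm a (u \<omega>)))\<^sup>2) = m"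
    using cmod2_sum_std_complex_gaussian[where c = ?c, OF _ _ ind g c] unfolding herm_def sum_c by auto
  have norm2: "(norm x)\<^sup>2 = (\<Sum>i\<in>UNIV. (cmod (x $ i))\<^sup>2)" for x :: "complex ^ 'm"
    by (simp add: norm_vec_def L2_set_def sum_nonneg)
  \<comment> \<open>All coefficients have modulus 1, so the mixed moment is the same for each
    \<open>i\<close>, with \<open>Q = m\<close>; summing over \<open>i\<close> multiplies it by
    \<open>m\<close>.\<close>
  have mix: "integrable M (\<lambda>\<omega>. (cmod (u \<omega> $ i))\<^sup>2 * cmod (herm a (u \<omega>)))"
    "expectation (\<lambda>\<omega>. (cmod (u \<omega> $ i))\<^sup>2 * cmod (herm a (u \<omega>))) = sqrt pi / 2 * (sqrt m + 1 / (2 * sqrt m))" for i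
    using cmod2_mult_cmod_sum_std_complex_gaussian[where c = ?c, OF _ _ ind g c, of i] a[of i] unfolding herm_def sum_c by auto
  show "integrable M (\<lambda>\<omega>. (norm (u \<omega>))\<^sup>2 * cmod (herm a (u \<omega>)))"
    unfolding norm2 sum_distrib_right using mix by auto
  have m: "m > 0" by (simp add: m_def)
  then have "m * (sqrt m + 1 / (2 * sqrt m)) = sqrt m * (m + 1 / 2)"
    by (simp add: field_simps)
  moreover have "expectation (\<lambda>\<omega>. (norm (u \<omega>))\<^sup>2 * cmod (herm a (u \<omega>)))
      = m * (sqrt pi / 2 * (sqrt m + 1 / (2 * sqrt m)))"
    unfolding norm2 sum_distrib_right
    by (simp only: Bochner_Integration.integral_sum mix sum_constant m_def)
  ultimately show "expectation (\<lambda>\<omega>. (norm (u \<omega>))\<^sup>2 * cmod (herm a (u \<omega>))) = sqrt pi / 2 * sqrt m * (m + 1 / 2)"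
    by (metis mult.assoc mult.left_commute)
  \<comment> \<open>Orders 0, 1 and 2 of the squared modulus are orders 0, 2 and 4 of the modulus
    itself.\<close>
  let ?mom = "\<lambda>k. [1, 1, 2 :: real] ! k"
  have "integrable M (\<lambda>\<omega>. ((cmod (u \<omega> $ i))\<^sup>2) ^ k) \<and> expectation (\<lambda>\<omega>. ((cmod (u \<omega> $ i))\<^sup>2) ^ k) = ?mom k"
    if "k \<le> 2" for i k
  proof -
    have "k = 0 \<or> k = 1 \<or> k = 2" using that by auto
    then show ?thesis
      using std_complex_gaussian_cmod_moments[OF g[of i], of 2]
        std_complex_gaussian_cmod_moments[OF g[of i], of 4]
      by (elim disjE) (auto simp: prob_space simp flip: power_mult)
  qed
  moreover have "indep_vars (\<lambda>_. borel) (\<lambda>i \<omega>. (cmod (u \<omega> $ i))\<^sup>2) UNIV"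
    by (rule indep_vars_compose2[OF ind, where Y = "\<lambda>_ x. (cmod x)\<^sup>2"]) simp
  ultimately have S: "integrable M (\<lambda>\<omega>. ((norm (u \<omega>))\<^sup>2) ^ k) \<and>
      expectation (\<lambda>\<omega>. ((norm (u \<omega>))\<^sup>2) ^ k) = iid_sum_moment ?mom CARD('m) k" if "k \<le> 2" for k
    unfolding norm2 using that by (intro sum_indep_power[where K = 2]) auto
  show "integrable M (\<lambda>\<omega>. (norm (u \<omega>))\<^sup>2)" "expectation (\<lambda>\<omega>. (norm (u \<omega>))\<^sup>2) = m"
    using S[of 1] by (auto simp: iid_sum_moment_1 m_def)
  show "integrable M (\<lambda>\<omega>. ((norm (u \<omega>))\<^sup>2)\<^sup>2)" "expectation (\<lambda>\<omega>. ((norm (u \<omega>))\<^sup>2)\<^sup>2) = m\<^sup>2 + m"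
    using S[of 2] by (auto simp: iid_sum_moment_2 m_def power2_eq_square algebra_simps)
qed

text \<open>\<open>Y\<close> is a sum of independent Rayleigh variables with common moments, so the
  closed forms of \<open>iid_sum_moment\<close> apply. They identify \<open>C_u1\<close> and
  \<open>C_u2\<close> as the third and fourth moments of \<open>Y\<close>.\<close>

lemma (in prob_space) sum_cmod_moments:
  fixes v :: "'a \<Rightarrow> complex ^ 'n"
  assumes v: "std_complex_gaussian_vec M v"
  defines "N \<equiv> CARD('n)" and "Y \<equiv> \<lambda>\<omega>. \<Sum>n\<in>UNIV. cmod (v \<omega> $ n)"
  shows "k \<le> 4 \<Longrightarrow> integrable M (\<lambda>\<omega>. Y \<omega> ^ k)"
    and "expectation Y = N * sqrt pi / 2"
    and "expectation (\<lambda>\<omega>. (Y \<omega>)\<^sup>2) = N + F_u N"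
    and "expectation (\<lambda>\<omega>. Y \<omega> ^ 3) = C_u1 N"
    and "expectation (\<lambda>\<omega>. Y \<omega> ^ 4) = C_u2 N"
proof -
  have ind: "indep_vars (\<lambda>_. borel) (\<lambda>n \<omega>. v \<omega> $ n) UNIV"
    and g: "\<And>n. std_complex_gaussian M (\<lambda>\<omega>. v \<omega> $ n)"
    using v by (auto simp: std_complex_gaussian_vec_def)
  let ?mom = "\<lambda>k. [1, sqrt pi / 2, 1, 3 / 4 * sqrt pi, 2] ! k"
  have "integrable M (\<lambda>\<omega>. cmod (v \<omega> $ n) ^ k) \<and> expectation (\<lambda>\<omega>. cmod (v \<omega> $ n) ^ k) = ?mom k"
    if "k \<le> 4" for n k
  proof (cases "k = 0")
    case False
    with that have k: "k \<in> {1, 2, 3, 4}" by auto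
    with std_complex_gaussian_cmod_moments[OF g[of n] k] show ?thesis
      by auto
  qed (simp add: prob_space)
  moreover have "indep_vars (\<lambda>_. borel) (\<lambda>n \<omega>. cmod (v \<omega> $ n)) UNIV"
    by (rule indep_vars_compose2[OF ind, where Y = "\<lambda>_. cmod"]) simp
  ultimately have Y: "integrable M (\<lambda>\<omega>. Y \<omega> ^ k) \<and>
      expectation (\<lambda>\<omega>. Y \<omega> ^ k) = iid_sum_moment ?mom N k" if "k \<le> 4" for k
    unfolding Y_def N_def using that by (intro sum_indep_power[where K = 4]) auto
  show "k \<le> 4 \<Longrightarrow> integrable M (\<lambda>\<omega>. Y \<omega> ^ k)"
    using Y by blast
  have p2: "sqrt pi ^ 2 = pi" and p3: "sqrt pi ^ 3 = pi * sqrt pi" and p4: "sqrt pi ^ 4 = pi\<^sup>2"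
    by (simp_all add: power3_eq_cube power4_eq_xxxx power2_eq_square)
  have p2': "sqrt pi * (sqrt pi * x) = pi * x" for x
    by (simp flip: mult.assoc)
  have N2: "real (N choose 2) = real N * (real N - 1) / 2"
    by (cases N) (simp_all add: choose_two real_of_nat_div algebra_simps)
  show "expectation Y = N * sqrt pi / 2"
    using Y[of 1] by (simp add: iid_sum_moment_1)
  show "expectation (\<lambda>\<omega>. (Y \<omega>)\<^sup>2) = N + F_u N"
    using Y[of 2] by (simp add: iid_sum_moment_2 F_u_def power_divide p2)
  show "expectation (\<lambda>\<omega>. Y \<omega> ^ 3) = C_u1 N"
    using Y[of 3] by (simp add: iid_sum_moment_3 C_u1_def power_divide p3 field_simps)
  show "expectation (\<lambda>\<omega>. Y \<omega> ^ 4) = C_u2 N"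
    using Y[of 4] by (simp add: iid_sum_moment_4 C_u2_def N2 power_divide p2 p2' p4 field_simps)
qed

section \<open>Assembly of the mean and the variance\<close>

theorem mainTheorem3:
  fixes P :: "'w measure"
    and M N :: nat
    and \<beta>d \<beta>br \<beta>ru \<tau> :: real
    and ab :: "complex ^ 'm" and ar :: "complex ^ 'n"
    and ud :: "'w \<Rightarrow> complex ^ 'm" and htru :: "'w \<Rightarrow> complex ^ 'n"
    and SNR :: "'w \<Rightarrow> real"
  assumes "M = CARD('m)" and "N = CARD('n)"
    and "\<beta>d > 0" and "\<beta>br > 0" and "\<beta>ru > 0" and "\<tau> > 0"
    and "\<And>i. cmod (ab $ i) = 1" and "\<And>n. cmod (ar $ n) = 1"
    and "prob_space P"
    and "std_complex_gaussian_vec P ud" and "std_complex_gaussian_vec P htru"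
    and "indep_rv P ud htru"
    and "SNR = (\<lambda>\<omega>. optimal_snr \<beta>d \<beta>br \<beta>ru \<tau> ab ar (ud \<omega>) (htru \<omega>))"
  shows "prob_space.expectation P SNR =
      (\<beta>d * real M + sqrt (real M) * real N * pi / 2 * sqrt (\<beta>d * \<beta>br * \<beta>ru)
        + \<beta>br * \<beta>ru * real M * (real N + F_u N)) * \<tau>
    \<and> prob_space.variance P SNR =
      (\<beta>d\<^sup>2 * real M
        + \<beta>d powr (3 / 2) * sqrt (\<beta>br * \<beta>ru) * real N * pi * (B_u M - real M powr (3 / 2))
        + \<beta>d * \<beta>br * \<beta>ru * real M * (4 * (real N + F_u N) - (real N)\<^sup>2 * pi\<^sup>2 / 4)
        + real M powr (3 / 2) * sqrt \<beta>d * (\<beta>br * \<beta>ru) powr (3 / 2)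
            * (2 * sqrt pi * C_u1 N - real N * (real N + F_u N) * pi)
        + (real M * \<beta>br * \<beta>ru)\<^sup>2 * (C_u2 N - (real N + F_u N)\<^sup>2)) * \<tau>\<^sup>2"
proof -
  interpret prob_space P by fact
  define S where "S = (\<lambda>\<omega>. (norm (ud \<omega>))\<^sup>2)"
  define X where "X = (\<lambda>\<omega>. cmod (herm ab (ud \<omega>)))"
  define Y where "Y = (\<lambda>\<omega>. \<Sum>n\<in>UNIV. cmod (htru \<omega> $ n))"
  \<comment> \<open>With square roots as the basic quantities, all fractional powers become integer
    powers and the final identities become polynomial.\<close>
  define d c m p n where "d = sqrt \<beta>d" and "c = sqrt (\<beta>br * \<beta>ru)" and "m = sqrt M" and "p = sqrt pi"
    and "n = real N"
  have sq: "\<beta>d = d\<^sup>2" "\<beta>br * \<beta>ru = c\<^sup>2" "real M = m\<^sup>2" "pi = p\<^sup>2"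
    using assms by (auto simp: d_def c_def m_def p_def)
  have nonneg: "m \<ge> 0"
    by (simp add: m_def)
  have SXY: "(norm (ud \<omega>))\<^sup>2 = S \<omega>" "cmod (herm ab (ud \<omega>)) = X \<omega>"
      "(\<Sum>n\<in>UNIV. cmod (htru \<omega> $ n)) = Y \<omega>" for \<omega>
    by (simp_all add: S_def X_def Y_def)
  note U = norm_and_herm_moments[OF \<open>std_complex_gaussian_vec P ud\<close> assms(7),
      unfolded SXY, folded assms(1) m_def]
  note V = sum_cmod_moments[OF \<open>std_complex_gaussian_vec P htru\<close>, unfolded SXY, folded assms(2) n_def]
  have [measurable]: "ud \<in> borel_measurable P" "htru \<in> borel_measurable P"
    using \<open>indep_rv P ud htru\<close> by (auto simp: indep_rv_def)
  have nth [measurable]: "(\<lambda>x :: complex ^ 'k. x $ i) \<in> borel_measurable borel" for i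
    by (intro borel_measurable_continuous_onI continuous_intros)
  have herm_m [measurable]: "herm ab \<in> borel_measurable borel"
    unfolding herm_def by measurable
  \<comment> \<open>Letting \<open>f\<close> depend on both the norm and \<open>herm ab\<close>
    covers \<open>S\<close>, \<open>X\<close>, \<open>X\<^sup>2\<close> and the dependent product
    \<open>S * X\<close> at once.\<close>
  have ind: "indep_var borel (\<lambda>\<omega>. f (norm (ud \<omega>)) (herm ab (ud \<omega>))) borel (\<lambda>\<omega>. Y \<omega> ^ k)"
    if [measurable]: "case_prod f \<in> borel_measurable (borel \<Otimes>\<^sub>M borel)" for f :: "real \<Rightarrow> complex \<Rightarrow> real" and k
    unfolding Y_def
    by (rule indep_rv_compose[OF \<open>indep_rv P ud htru\<close>, of "\<lambda>x. f (norm x) (herm ab x)" "\<lambda>x. (\<Sum>n\<in>UNIV. cmod (x $ n)) ^ k"]) measurable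
  have prod: "integrable P (\<lambda>\<omega>. f (norm (ud \<omega>)) (herm ab (ud \<omega>)) * Y \<omega> ^ k)"
      "expectation (\<lambda>\<omega>. f (norm (ud \<omega>)) (herm ab (ud \<omega>)) * Y \<omega> ^ k) =
        expectation (\<lambda>\<omega>. f (norm (ud \<omega>)) (herm ab (ud \<omega>))) * expectation (\<lambda>\<omega>. Y \<omega> ^ k)"
    if "case_prod f \<in> borel_measurable (borel \<Otimes>\<^sub>M borel)"
      "integrable P (\<lambda>\<omega>. f (norm (ud \<omega>)) (herm ab (ud \<omega>)))" "k \<le> 4" for f k
    using indep_var_integrable[OF ind[OF that(1)] that(2) V(1)[OF that(3)]]
      indep_var_lebesgue_integral[OF ind[OF that(1)] that(2) V(1)[OF that(3)]] by auto
  have S2: "integrable P (\<lambda>\<omega>. S \<omega> * (Y \<omega>)\<^sup>2)"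
      "expectation (\<lambda>\<omega>. S \<omega> * (Y \<omega>)\<^sup>2) = expectation S * expectation (\<lambda>\<omega>. (Y \<omega>)\<^sup>2)"
    and X1: "integrable P (\<lambda>\<omega>. X \<omega> * Y \<omega>)"
      "expectation (\<lambda>\<omega>. X \<omega> * Y \<omega>) = expectation X * expectation Y"
    and X3: "integrable P (\<lambda>\<omega>. X \<omega> * Y \<omega> ^ 3)"
      "expectation (\<lambda>\<omega>. X \<omega> * Y \<omega> ^ 3) = expectation X * expectation (\<lambda>\<omega>. Y \<omega> ^ 3)"
    and X22: "integrable P (\<lambda>\<omega>. (X \<omega>)\<^sup>2 * (Y \<omega>)\<^sup>2)"
      "expectation (\<lambda>\<omega>. (X \<omega>)\<^sup>2 * (Y \<omega>)\<^sup>2) = expectation (\<lambda>\<omega>. (X \<omega>)\<^sup>2) * expectation (\<lambda>\<omega>. (Y \<omega>)\<^sup>2)"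
    and SX: "integrable P (\<lambda>\<omega>. S \<omega> * X \<omega> * Y \<omega>)"
      "expectation (\<lambda>\<omega>. S \<omega> * X \<omega> * Y \<omega>) = expectation (\<lambda>\<omega>. S \<omega> * X \<omega>) * expectation Y"
    using prod[of "\<lambda>x z. x\<^sup>2" 2] prod[of "\<lambda>x z. cmod z" 1] prod[of "\<lambda>x z. cmod z" 3]
      prod[of "\<lambda>x z. (cmod z)\<^sup>2" 2] prod[of "\<lambda>x z. x\<^sup>2 * cmod z" 1] U
    by (auto simp: S_def X_def)
  \<comment> \<open>\<open>T\<close> is the SNR divided by \<open>\<tau>\<close> without the
    exceptional case; the two agree almost surely, hence have the same moments.\<close>
  define T where "T = (\<lambda>\<omega>. d\<^sup>2 * S \<omega> + 2 * d * c * (X \<omega> * Y \<omega>) + c\<^sup>2 * m\<^sup>2 * (Y \<omega>)\<^sup>2)"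
  have [measurable]: "T \<in> borel_measurable P"
    unfolding T_def S_def X_def Y_def by measurable
  have 1: "sqrt (\<beta>d * \<beta>br * \<beta>ru) = d * c"
    by (simp add: d_def c_def real_sqrt_mult mult.assoc)
  have SNR: "SNR \<omega> = (d\<^sup>2 * S \<omega> + 2 * d * c * (X \<omega> * Y \<omega>)
      + c\<^sup>2 * m\<^sup>2 * (if herm ab (ud \<omega>) = 0 then 0 else (Y \<omega>)\<^sup>2)) * \<tau>" for \<omega>
    unfolding assms(13) optimal_snr_eq[OF assms(7,8,3,4,5)]
    unfolding SXY 1 assms(1)[symmetric]
    unfolding sq(1-3) by (simp add: mult.assoc)
  have [measurable]: "SNR \<in> borel_measurable P"
    unfolding SNR[abs_def] S_def X_def Y_def by measurable
  have AE_T: "AE \<omega> in P. SNR \<omega> = T \<omega> * \<tau>"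
    using U(1) by eventually_elim (simp add: SNR T_def)
  have vals: "expectation S = m\<^sup>2" "expectation (\<lambda>\<omega>. (S \<omega>)\<^sup>2) = m ^ 4 + m\<^sup>2"
      "expectation X = p / 2 * m" "expectation (\<lambda>\<omega>. (X \<omega>)\<^sup>2) = m\<^sup>2"
      "expectation (\<lambda>\<omega>. S \<omega> * X \<omega>) = p / 2 * m * (m\<^sup>2 + 1 / 2)"
      "expectation Y = n * p / 2" "expectation (\<lambda>\<omega>. (Y \<omega>)\<^sup>2) = n + F_u N"
      "expectation (\<lambda>\<omega>. Y \<omega> ^ 3) = C_u1 N" "expectation (\<lambda>\<omega>. Y \<omega> ^ 4) = C_u2 N"
    using U V nonneg by (simp_all add: sq(3) p_def n_def)
  have ints: "integrable P S" "integrable P (\<lambda>\<omega>. (S \<omega>)\<^sup>2)"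
      "integrable P (\<lambda>\<omega>. (Y \<omega>)\<^sup>2)" "integrable P (\<lambda>\<omega>. Y \<omega> ^ 4)"
    using U V(1) by auto
  note integrate = Bochner_Integration.integral_add Bochner_Integration.integral_mult_right_zero
    Bochner_Integration.integrable_add Bochner_Integration.integrable_mult_right
    ints S2 X1 X3 X22 SX vals
  have ET: "integrable P T" "expectation T = d\<^sup>2 * m\<^sup>2 + 2 * d * c * (p / 2 * m * (n * p / 2)) + c\<^sup>2 * m\<^sup>2 * (n + F_u N)"
    unfolding T_def by (simp_all only: integrate)
  \<comment> \<open>Each of the six monomials is a function of the direct channel times a power of
    \<open>Y\<close>, so its expectation factors; \<open>S\<close> and \<open>X\<close> stay
    together because they are dependent.\<close>
  have T2: "(T \<omega>)\<^sup>2 = d^4 * (S \<omega>)\<^sup>2 + 4 * d\<^sup>2 * c\<^sup>2 * ((X \<omega>)\<^sup>2 * (Y \<omega>)\<^sup>2) + c^4 * m^4 * Y \<omega> ^ 4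
      + 4 * d^3 * c * (S \<omega> * X \<omega> * Y \<omega>) + 2 * d\<^sup>2 * c\<^sup>2 * m\<^sup>2 * (S \<omega> * (Y \<omega>)\<^sup>2)
      + 4 * d * c^3 * m\<^sup>2 * (X \<omega> * Y \<omega> ^ 3)" for \<omega>
    unfolding T_def by algebra
  have ET2: "integrable P (\<lambda>\<omega>. (T \<omega>)\<^sup>2)" "expectation (\<lambda>\<omega>. (T \<omega>)\<^sup>2) =
      d^4 * (m^4 + m\<^sup>2) + 4 * d\<^sup>2 * c\<^sup>2 * (m\<^sup>2 * (n + F_u N)) + c^4 * m^4 * C_u2 N
      + 4 * d^3 * c * (p / 2 * m * (m\<^sup>2 + 1 / 2) * (n * p / 2)) + 2 * d\<^sup>2 * c\<^sup>2 * m\<^sup>2 * (m\<^sup>2 * (n + F_u N))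
      + 4 * d * c^3 * m\<^sup>2 * (p / 2 * m * C_u1 N)"
    unfolding T2 by (simp_all only: integrate)
  have E: "expectation SNR = expectation T * \<tau>"
    using AE_T by (subst integral_cong_AE[where g = "\<lambda>\<omega>. T \<omega> * \<tau>"]) auto
  have "expectation (\<lambda>\<omega>. (SNR \<omega> - expectation SNR)\<^sup>2) = expectation (\<lambda>\<omega>. (T \<omega> - expectation T)\<^sup>2 * \<tau>\<^sup>2)"
    unfolding E using AE_T
    by (intro integral_cong_AE) (auto simp: power2_eq_square algebra_simps)
  then have Var: "variance SNR = variance T * \<tau>\<^sup>2"
    by simp
  have VT: "variance T = expectation (\<lambda>\<omega>. (T \<omega>)\<^sup>2) - (expectation T)\<^sup>2"
    by (rule variance_eq[OF ET(1) ET2(1)])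
  have powr: "\<beta>d powr (3 / 2) = d ^ 3" "(\<beta>br * \<beta>ru) powr (3 / 2) = c ^ 3" "real M powr (3 / 2) = m ^ 3"
    using assms by (auto simp: powr_three_halves d_def c_def m_def)
  show ?thesis
  proof
    show "expectation SNR =
      (\<beta>d * real M + sqrt (real M) * real N * pi / 2 * sqrt (\<beta>d * \<beta>br * \<beta>ru)
        + \<beta>br * \<beta>ru * real M * (real N + F_u N)) * \<tau>"
      unfolding E ET(2) 1 m_def[symmetric] n_def[symmetric]
      unfolding sq by (simp add: power2_eq_square)
    show "variance SNR = (\<beta>d\<^sup>2 * real M
        + \<beta>d powr (3 / 2) * sqrt (\<beta>br * \<beta>ru) * real N * pi * (B_u M - real M powr (3 / 2))
        + \<beta>d * \<beta>br * \<beta>ru * real M * (4 * (real N + F_u N) - (real N)\<^sup>2 * pi\<^sup>2 / 4)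
        + real M powr (3 / 2) * sqrt \<beta>d * (\<beta>br * \<beta>ru) powr (3 / 2)
            * (2 * sqrt pi * C_u1 N - real N * (real N + F_u N) * pi)
        + (real M * \<beta>br * \<beta>ru)\<^sup>2 * (C_u2 N - (real N + F_u N)\<^sup>2)) * \<tau>\<^sup>2"
    proof -
      have *: "\<beta>d * \<beta>br * \<beta>ru * real M = d\<^sup>2 * c\<^sup>2 * m\<^sup>2" "real M * \<beta>br * \<beta>ru = m\<^sup>2 * c\<^sup>2"
        using sq by (simp_all add: mult.assoc)
      \<comment> \<open>Up to the factor \<open>p / 2\<close> this difference is the covariance of
        \<open>S\<close> and \<open>X\<close>.\<close>
      have B: "B_u M - real M powr (3 / 2) = m / 2"
        by (simp add: B_u_def m_def)
      show ?thesis
        \<comment> \<open>Subtracting the squared mean cancels \<open>d^4 * m^4\<close> and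
          \<open>2 * d\<^sup>2 * c\<^sup>2 * m^4 * (n + F_u N)\<close>; the squared mean of the
          cross term gives the contribution with \<open>pi\<^sup>2 / 4\<close>.\<close>
        unfolding Var VT B *
        unfolding ET(2) ET2(2) powr p_def[symmetric] d_def[symmetric] c_def[symmetric]
          n_def[symmetric]
        unfolding sq
        by (simp add: field_simps power2_eq_square power3_eq_cube power4_eq_xxxx)
    qed
  qed
qed

end
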